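(* Let $\lambda$ be a straight or skew shape with $n$ boxes. Then for every $m\in\mathbb N=\{1,2,3,\dots\}$, $\rho^{\lambda,m}\cong S^\lambda\uparrow_{S_n}^{B_n}$.
   Context: $B_n$ is the group of permutations $\pi$ of $\{\pm1,\dots,\pm n\}$ with $\pi(-i)=-\pi(i)$, with Coxeter generators $s_0=(-1,1)$ and $s_i=(i,i+1)(-i,-i-1)$, $1\le i\le n-1$; $S_n=\langle s_1,\dots,s_{n-1}\rangle$, identified with the symmetric group via $s_i\mapsto(i\,\,i{+}1)$. $S^\lambda$ is the representation of $S_n$ on the space with basis the standard Young tableaux $Q$ of shape $\lambda$ filled with $1,\dots,n$, given by $(i\,\,i{+}1)(Q)=\frac1hQ+\sqrt{1-\frac1{h^2}}\,Q^{s_i}$, with $h$ the content of $i+1$ minus the content of $i$ in $Q$ (content of box in row $r$, column $j$ being $j-r$) and $Q^{s_i}$ obtained by swapping $i,i+1$. For a B-Young tableau, the content of the box in row $r$, column $j$ is $j-r+\frac12$. A B-Young tableau is a filling of a skew diagram by $\pm1,\dots,\pm n$, one per box, with $c_{-k}=-c_k$ ($c_k$ the content of the box containing $k$); standard means increasing along rows and down columns. A B-Young tableau is regarded as determined by its positive-content part. For $\pi\in B_n$, $T^\pi$ is $T$ with each entry $k$ replaced by $\pi(k)$. For $m\in\mathbb N$, $T[\lambda,m]$ is the set of standard B-Young tableaux whose positive-content boxes form the shape $\lambda$ and whose smallest positive content is $m+\frac12$. For such $T$ with content vector $(c_1,\dots,c_n)$ let $f(T)=(2c_1,c_2-c_1,\dots,c_n-c_{n-1})$.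 $\rho^{\lambda,m}$ is the representation of $B_n$ on the vector space with basis $T[\lambda,m]$ given by $\rho_{s_i}(T)=\frac1{f_i(T)}T+\sqrt{1-\frac1{f_i(T)^2}}\,T^{s_i}$, $i=0,\dots,n-1$ (the second term vanishing when $f_i(T)=\pm1$, i.e. when $T^{s_i}$ is not standard). *)

theory Defs
  imports "HOL-Combinatorics.Combinatorics" Complex_Main
begin

(* Boxes are (row, column) pairs; rows and columns are numbered from 1. *)
type_synonym box = "int \<times> int"
type_synonym filling = "box \<Rightarrow> int"   (* entries; value 0 outside the diagram *)
type_synonym sperm = "int \<Rightarrow> int"

definition signed_set :: "nat \<Rightarrow> int set" where
  "signed_set n = {k. k \<noteq> 0 \<and> \<bar>k\<bar> \<le> int n}"

definition Bgroup :: "nat \<Rightarrow> sperm set" where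
  "Bgroup n = {\<pi>. \<pi> permutes signed_set n \<and> (\<forall>k. \<pi> (- k) = - \<pi> k)}"

(* S_n = <s_1,...,s_{n-1}> = signed permutations preserving the sign of every entry *)
definition Sgroup :: "nat \<Rightarrow> sperm set" where
  "Sgroup n = {\<pi> \<in> Bgroup n. \<forall>k>0. \<pi> k > 0}"

definition gen :: "nat \<Rightarrow> sperm" where
  "gen i = (if i = 0 then transpose (-1) 1
            else transpose (int i) (int i + 1) \<circ> transpose (- int i) (- int i - 1))"

definition word_perm :: "nat list \<Rightarrow> sperm" where
  "word_perm ws = foldr (\<lambda>i p. gen i \<circ> p) ws id"

definition act :: "sperm \<Rightarrow> filling \<Rightarrow> filling" where
  "act \<pi> T = (\<lambda>b. \<pi> (T b))"

definition mat_mult :: "'b set \<Rightarrow> ('a \<Rightarrow> 'b \<Rightarrow> real) \<Rightarrow> ('b \<Rightarrow> 'c \<Rightarrow> real) \<Rightarrow> 'a \<Rightarrow> 'c \<Rightarrow> real" where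
  "mat_mult Z A B = (\<lambda>a c. \<Sum>b\<in>Z. A a b * B b c)"

definition mat_id :: "'a \<Rightarrow> 'a \<Rightarrow> real" where
  "mat_id = (\<lambda>a c. if a = c then 1 else 0)"

(* matrix of a word in the generators, M i y x = coefficient of basis vector y in rho_{s_i}(x) *)
definition word_mat :: "'x set \<Rightarrow> (nat \<Rightarrow> 'x \<Rightarrow> 'x \<Rightarrow> real) \<Rightarrow> nat list \<Rightarrow> 'x \<Rightarrow> 'x \<Rightarrow> real" where
  "word_mat X M ws = foldr (\<lambda>i A. mat_mult X (M i) A) ws mat_id"

(* the representation of the group generated by {gen i | i in I} determined by the
   generator matrices M: the matrix of w is the product of generator matrices along
   any word for w (well defined precisely because M defines a representation) *)
definition ext_rep :: "'x set \<Rightarrow> (nat \<Rightarrow> 'x \<Rightarrow> 'x \<Rightarrow> real) \<Rightarrow> nat set \<Rightarrow> sperm \<Rightarrow> 'x \<Rightarrow> 'x \<Rightarrow> real" where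
  "ext_rep X M I w = (THE A. \<forall>ws. set ws \<subseteq> I \<and> word_perm ws = w \<longrightarrow>
       A = (\<lambda>a c. if a \<in> X \<and> c \<in> X then word_mat X M ws a c else 0))"

definition rep_iso :: "'x set \<Rightarrow> 'y set \<Rightarrow> sperm set \<Rightarrow> (sperm \<Rightarrow> 'x \<Rightarrow> 'x \<Rightarrow> real)
    \<Rightarrow> (sperm \<Rightarrow> 'y \<Rightarrow> 'y \<Rightarrow> real) \<Rightarrow> bool" where
  "rep_iso X Y G A B \<longleftrightarrow> (\<exists>(P :: 'y \<Rightarrow> 'x \<Rightarrow> real) (Q :: 'x \<Rightarrow> 'y \<Rightarrow> real).
      (\<forall>a\<in>X. \<forall>c\<in>X. mat_mult Y Q P a c = mat_id a c) \<and>
      (\<forall>a\<in>Y. \<forall>c\<in>Y. mat_mult X P Q a c = mat_id a c) \<and>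
      (\<forall>g\<in>G. \<forall>y\<in>Y. \<forall>x\<in>X. mat_mult X P (A g) y x = mat_mult Y (B g) P y x))"

definition transversal :: "sperm set \<Rightarrow> sperm set \<Rightarrow> sperm set" where
  "transversal G H = (\<lambda>C. SOME r. r \<in> C) ` {(\<lambda>h. g \<circ> h) ` H | g. g \<in> G}"

definition induced_basis :: "sperm set \<Rightarrow> sperm set \<Rightarrow> 'x set \<Rightarrow> (sperm \<times> 'x) set" where
  "induced_basis G H X = transversal G H \<times> X"

(* g (r (x) v) = r' (x) sigma(h) v  where g r = r' h, h in H *)
definition induced_rep :: "sperm set \<Rightarrow> (sperm \<Rightarrow> 'x \<Rightarrow> 'x \<Rightarrow> real)
    \<Rightarrow> sperm \<Rightarrow> (sperm \<times> 'x) \<Rightarrow> (sperm \<times> 'x) \<Rightarrow> real" where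
  "induced_rep H \<sigma> g = (\<lambda>(r', v') (r, v).
     if inv r' \<circ> g \<circ> r \<in> H then \<sigma> (inv r' \<circ> g \<circ> r) v' v else 0)"

definition partition_diagram :: "box set \<Rightarrow> bool" where
  "partition_diagram L \<longleftrightarrow> finite L \<and> (\<forall>(r, j) \<in> L. 1 \<le> r \<and> 1 \<le> j) \<and>
     (\<forall>r j r' j'. (r, j) \<in> L \<and> 1 \<le> r' \<and> r' \<le> r \<and> 1 \<le> j' \<and> j' \<le> j \<longrightarrow> (r', j') \<in> L)"

definition skew_shape :: "box set \<Rightarrow> bool" where
  "skew_shape D \<longleftrightarrow> (\<exists>L M. partition_diagram L \<and> partition_diagram M \<and> M \<subseteq> L \<and> D = L - M)"

definition content :: "box \<Rightarrow> int" where
  "content b = snd b - fst b"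

definition standard :: "box set \<Rightarrow> filling \<Rightarrow> bool" where
  "standard D T \<longleftrightarrow>
     (\<forall>r j j'. (r, j) \<in> D \<and> (r, j') \<in> D \<and> j < j' \<longrightarrow> T (r, j) < T (r, j')) \<and>
     (\<forall>r r' j. (r, j) \<in> D \<and> (r', j) \<in> D \<and> r < r' \<longrightarrow> T (r, j) < T (r', j))"

definition box_of :: "box set \<Rightarrow> filling \<Rightarrow> int \<Rightarrow> box" where
  "box_of D T k = (THE b. b \<in> D \<and> T b = k)"

definition syt :: "box set \<Rightarrow> nat \<Rightarrow> filling set" where
  "syt D n = {Q. bij_betw Q D {1..int n} \<and> (\<forall>b. b \<notin> D \<longrightarrow> Q b = 0) \<and> standard D Q}"

(* seminormal matrix of (i i+1) on S^lambda *)
definition young_gen :: "box set \<Rightarrow> nat \<Rightarrow> filling \<Rightarrow> filling \<Rightarrow> real" where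
  "young_gen D i Q' Q =
     (let h = real_of_int (content (box_of D Q (int i + 1)) - content (box_of D Q (int i))) in
      (if Q' = Q then 1 / h else 0) + (if Q' = act (gen i) Q then sqrt (1 - 1 / h\<^sup>2) else 0))"

definition specht_rep :: "box set \<Rightarrow> nat \<Rightarrow> sperm \<Rightarrow> filling \<Rightarrow> filling \<Rightarrow> real" where
  "specht_rep D n = ext_rep (syt D n) (young_gen D) {1..<n}"

(* B-content of a box of the positive part: the shape D is placed so that its
   smallest content equals m + 1/2 *)
definition bcontent :: "box set \<Rightarrow> nat \<Rightarrow> box \<Rightarrow> real" where
  "bcontent D m b = real_of_int (content b - Min (content ` D)) + real m + 1 / 2"

(* T[lambda,m], each B-tableau represented by its positive-content part *)
definition Btab :: "box set \<Rightarrow> nat \<Rightarrow> nat \<Rightarrow> filling set" where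
  "Btab D m n = {T. inj_on T D \<and> T ` D \<subseteq> signed_set n \<and> (\<forall>b. b \<notin> D \<longrightarrow> T b = 0) \<and>
      (\<forall>k::int. 1 \<le> k \<and> k \<le> int n \<longrightarrow> (k \<in> T ` D \<longleftrightarrow> - k \<notin> T ` D)) \<and> standard D T}"

(* content c_k of the box containing k (c_{-k} = - c_k) *)
definition bcv :: "box set \<Rightarrow> nat \<Rightarrow> filling \<Rightarrow> int \<Rightarrow> real" where
  "bcv D m T k = (if k \<in> T ` D then bcontent D m (box_of D T k) else - bcontent D m (box_of D T (- k)))"

definition fvec :: "box set \<Rightarrow> nat \<Rightarrow> filling \<Rightarrow> nat \<Rightarrow> real" where
  "fvec D m T i = (if i = 0 then 2 * bcv D m T 1 else bcv D m T (int i + 1) - bcv D m T (int i))"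

definition rho_gen :: "box set \<Rightarrow> nat \<Rightarrow> nat \<Rightarrow> filling \<Rightarrow> filling \<Rightarrow> real" where
  "rho_gen D m i T' T =
     (let f = fvec D m T i in
      (if T' = T then 1 / f else 0) + (if T' = act (gen i) T then sqrt (1 - 1 / f\<^sup>2) else 0))"

definition rho_rep :: "box set \<Rightarrow> nat \<Rightarrow> nat \<Rightarrow> sperm \<Rightarrow> filling \<Rightarrow> filling \<Rightarrow> real" where
  "rho_rep D m n = ext_rep (Btab D m n) (rho_gen D m) {..<n}"

end

theory Submission
  imports "Jordan_Normal_Form.Determinant" Defs
begin

unbundle no m_inv_syntax

text \<open>
  The standard B-tableaux with positive entries only span a copy of \<open>S\<^sup>\<lambda>\<close> inside the restriction of
  \<open>\<rho>\<close> to \<open>S\<^sub>n\<close>, which by Frobenius reciprocity gives the intertwiner \<open>r \<otimes> Q \<mapsto> \<rho>(r) Q\<close> from the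
  induced representation to \<open>\<rho>\<close>. It is onto: a swap of \<open>k\<close> with \<open>-k-1\<close>, or of \<open>1\<close> with \<open>-1\<close>, has a
  denominator of absolute value at least \<open>3\<close> because \<open>m \<ge> 1\<close>, so its off-diagonal coefficient does not
  vanish and the positive tableaux generate \<open>\<rho>\<close>. Both sides have dimension \<open>2\<^sup>n\<close> times the number of standard
  Young tableaux. That the generator matrices define representations at all follows from the Coxeter
  presentation of \<open>B\<^sub>n\<close>, itself obtained from the normal form of a word along the cosets of \<open>B\<^sub>n\<^sub>-\<^sub>1\<close>; the
  case of \<open>S\<^sub>n\<close> is then a restriction of that of \<open>B\<^sub>n\<close>.
\<close>

section \<open>Words in the Coxeter generators\<close>

text \<open>Both representations are descriptions ranging over all words for a group element, so
  \<open>rho_rep\<close> and \<open>specht_rep\<close> have no usable value until words with equal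
  permutations are known to have equal matrices. The obstacle is the braid relations: between two
  standard tableaux a braid may pass through fillings that are not standard, which would split each
  relation into many cases. The generators are therefore read as operators on functions on all
  fillings, where relabelling is always possible; a step from a standard filling to a non-standard
  one carries the coefficient sqrt(1 - 1/f^2) = 0, so values at standard tableaux are unaffected. Up
  to sign, the denominators met along a braid are the values of the positive roots of a rank two
  root system at the content vector, and each braid relation becomes a polynomial identity modulo
  partial fractions of their reciprocals.\<close>

lemma word_perm_Nil [simp]: "word_perm [] = id"
  by (simp add: word_perm_def)

lemma word_perm_Cons [simp]: "word_perm (i # ws) = gen i \<circ> word_perm ws"
  by (simp add: word_perm_def)

lemma word_perm_append [simp]: "word_perm (us @ ws) = word_perm us \<circ> word_perm ws"
  by (induction us) (simp_all add: comp_assoc)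

lemma gen_0: "gen 0 k = (if k = 1 then -1 else if k = -1 then 1 else k)"
  by (auto simp: gen_def transpose_def)

lemma gen_pos:
  "0 < i \<Longrightarrow> gen i k = (if k = int i then int i + 1 else if k = int i + 1 then int i
     else if k = - int i then - int i - 1 else if k = - int i - 1 then - int i else k)"
  by (auto simp: gen_def transpose_def)

lemma gen_apply:
  "gen i k = (if i = 0 then (if k = 1 then -1 else if k = -1 then 1 else k)
     else if k = int i then int i + 1 else if k = int i + 1 then int i
     else if k = - int i then - int i - 1 else if k = - int i - 1 then - int i else k)"
  using gen_0 gen_pos by auto

lemma gen_gen [simp]: "gen i (gen i k) = k"
  by (auto simp: gen_apply)

lemma gen_minus: "gen i (- k) = - gen i k"
  by (auto simp: gen_apply)

lemma gen_zero [simp]: "gen i 0 = 0"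
  by (auto simp: gen_apply)

lemma gen_fixes: "\<bar>k\<bar> \<noteq> int i \<Longrightarrow> \<bar>k\<bar> \<noteq> int i + 1 \<Longrightarrow> gen i k = k"
  by (auto simp: gen_apply)

lemma gen_commute:
  assumes "i + 1 < j" shows "gen i \<circ> gen j = gen j \<circ> gen i"
proof
  fix k
  show "(gen i \<circ> gen j) k = (gen j \<circ> gen i) k"
  \<comment> \<open>\<open>gen i\<close> preserves the set of letters of absolute value at most i +
    1 and \<open>gen j\<close> its complement; each fixes the other's part pointwise.\<close>
  proof (cases "\<bar>k\<bar> \<le> int i + 1")
    case True
    then have "\<bar>gen i k\<bar> \<le> int i + 1" by (auto simp: gen_apply)
    then show ?thesis using True assms gen_fixes[of k j] gen_fixes[of "gen i k" j] by simp
  next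
    case False
    then have "int i + 1 < \<bar>gen j k\<bar>" using assms by (auto simp: gen_apply)
    then show ?thesis using False assms gen_fixes[of k i] gen_fixes[of "gen j k" i] by simp
  qed
qed

lemma gen_braid:
  assumes "0 < i"
  shows "gen i \<circ> (gen (Suc i) \<circ> gen i) = gen (Suc i) \<circ> (gen i \<circ> gen (Suc i))"
proof
  fix k
  consider "k \<in> {int i, int i + 1, int i + 2}" | "- k \<in> {int i, int i + 1, int i + 2}"
    | "k \<notin> {int i, int i + 1, int i + 2}" "- k \<notin> {int i, int i + 1, int i + 2}" by blast
  then show "(gen i \<circ> (gen (Suc i) \<circ> gen i)) k = (gen (Suc i) \<circ> (gen i \<circ> gen (Suc i))) k"
  proof cases
    case 1
    then have "k = int i \<or> k = int i + 1 \<or> k = int i + 2" by auto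
    then show ?thesis using assms by (elim disjE) (simp_all add: gen_pos)
  next
    case 2
    then have "k = - int i \<or> k = - int i - 1 \<or> k = - int i - 2" by auto
    then show ?thesis using assms by (elim disjE) (simp_all add: gen_pos)
  next
    case 3
    then have "gen i k = k" "gen (Suc i) k = k" using assms by (auto simp: gen_pos)
    then show ?thesis by simp
  qed
qed

lemma gen_braid_0:
  "gen 0 \<circ> (gen (Suc 0) \<circ> (gen 0 \<circ> gen (Suc 0))) = gen (Suc 0) \<circ> (gen 0 \<circ> (gen (Suc 0) \<circ> gen 0))"
proof
  fix k :: int
  consider "k = 1" | "k = 2" | "k = -1" | "k = -2" | "k \<notin> {1, 2, -1, -2}" by blast
  then show "(gen 0 \<circ> (gen (Suc 0) \<circ> (gen 0 \<circ> gen (Suc 0)))) k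
      = (gen (Suc 0) \<circ> (gen 0 \<circ> (gen (Suc 0) \<circ> gen 0))) k"
  proof cases
    case 5
    then have "gen 0 k = k" "gen (Suc 0) k = k" by (auto simp: gen_apply)
    then show ?thesis by simp
  qed (simp_all add: gen_apply)
qed

lemma word_perm_rev_comp: "word_perm (rev ws) \<circ> word_perm ws = id"
proof (induction ws)
  case (Cons i ws)
  then show ?case by (simp add: fun_eq_iff)
qed simp

lemma word_perm_comp_rev: "word_perm ws \<circ> word_perm (rev ws) = id"
  using word_perm_rev_comp[of "rev ws"] by simp

lemma word_perm_left_cancel: "word_perm ws \<circ> f = word_perm ws \<circ> g \<Longrightarrow> f = g"
  by (metis comp_assoc comp_id id_comp word_perm_rev_comp)

lemma word_perm_fixes:
  "\<forall>i\<in>set ws. Suc i < n \<Longrightarrow> word_perm ws (int n) = int n"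
  by (induction ws) (auto simp: gen_apply)

text \<open>A word carrying the letter \<open>n\<close> to \<open>k\<close>: these represent the cosets of \<open>B\<^sub>n\<^sub>-\<^sub>1\<close> in \<open>B\<^sub>n\<close>.\<close>

definition coset_word :: "nat \<Rightarrow> int \<Rightarrow> nat list" where
  "coset_word n k = (if k > 0 then [nat k..<n] else rev [0..<nat (- k)] @ [1..<n])"

lemma coset_word_pos: "0 < k \<Longrightarrow> coset_word n (int k) = [k..<n]"
  by (simp add: coset_word_def)

lemma coset_word_neg: "0 < k \<Longrightarrow> coset_word n (- int k) = rev [0..<k] @ [1..<n]"
  by (simp add: coset_word_def)

lemma word_perm_upt:
  assumes "1 \<le> k" "k \<le> n" shows "word_perm [k..<n] (int n) = int k"
  using assms(2,1)
proof (induction rule: inc_induct)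
  case (step k)
  have "[k..<n] = k # [Suc k..<n]" using step by (simp add: upt_conv_Cons)
  then show ?case using step by (simp add: gen_pos)
qed simp

lemma word_perm_downt: "word_perm (rev [0..<k]) 1 = (if k = 0 then 1 else - int k)"
proof (induction k)
  case (Suc k)
  then show ?case by (cases k) (simp_all add: gen_apply)
qed simp

lemma signed_setE:
  assumes "k \<in> signed_set n"
  obtains j where "1 \<le> j" "j \<le> n" "k = int j" | j where "1 \<le> j" "j \<le> n" "k = - int j"
proof (cases "k > 0")
  case True
  then show ?thesis using assms that(1)[of "nat k"] by (auto simp: signed_set_def)
next
  case False
  then show ?thesis using assms that(2)[of "nat (- k)"] by (auto simp: signed_set_def)
qed

lemma word_perm_coset_word:
  assumes "k \<in> signed_set n" shows "word_perm (coset_word n k) (int n) = k"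
  using assms
proof (cases rule: signed_setE)
  case (1 j)
  then show ?thesis by (simp add: coset_word_pos word_perm_upt)
next
  case (2 j)
  then show ?thesis by (simp add: coset_word_neg word_perm_upt word_perm_downt)
qed

lemma set_coset_word: "k \<in> signed_set n \<Longrightarrow> set (coset_word n k) \<subseteq> {..<n}"
  by (auto simp: coset_word_def signed_set_def)

lemma gen_signed_set: "i < n \<Longrightarrow> k \<in> signed_set n \<Longrightarrow> gen i k \<in> signed_set n"
  by (auto simp: signed_set_def gen_apply)

section \<open>The Coxeter presentation, for an abstract congruence on words\<close>

locale coxeter_congruence =
  fixes N :: nat and E :: "nat list \<Rightarrow> nat list \<Rightarrow> bool"  (infix "\<approx>" 50)
  assumes refl: "ws \<approx> ws"
    and sym: "us \<approx> ws \<Longrightarrow> ws \<approx> us"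
    and trans [trans]: "us \<approx> vs \<Longrightarrow> vs \<approx> ws \<Longrightarrow> us \<approx> ws"
    and in_context: "us \<approx> ws \<Longrightarrow> xs @ us @ ys \<approx> xs @ ws @ ys"
    and perm: "us \<approx> ws \<Longrightarrow> word_perm us = word_perm ws"
    and square: "i < N \<Longrightarrow> [i, i] \<approx> []"
    and commute: "i + 1 < j \<Longrightarrow> j < N \<Longrightarrow> [i, j] \<approx> [j, i]"
    and braid: "0 < i \<Longrightarrow> Suc i < N \<Longrightarrow> [i, Suc i, i] \<approx> [Suc i, i, Suc i]"
    and braid_0: "1 < N \<Longrightarrow> [0, 1, 0, 1] \<approx> [1, 0, 1, 0]"
begin

lemma trans_eq [trans]: "us \<approx> vs \<Longrightarrow> vs = ws \<Longrightarrow> us \<approx> ws"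
  by simp

lemma append_left: "us \<approx> ws \<Longrightarrow> xs @ us \<approx> xs @ ws"
  using in_context[of us ws xs "[]"] by simp

lemma append_right: "us \<approx> ws \<Longrightarrow> us @ ys \<approx> ws @ ys"
  using in_context[of us ws "[]" ys] by simp

lemma commute': "i + 1 < j \<or> j + 1 < i \<Longrightarrow> i < N \<Longrightarrow> j < N \<Longrightarrow> [i, j] \<approx> [j, i]"
  using commute sym by blast

lemma commute_word:
  assumes "i < N" "\<And>j. j \<in> set ws \<Longrightarrow> j < N \<and> (i + 1 < j \<or> j + 1 < i)"
  shows "[i] @ ws \<approx> ws @ [i]"
  using assms(2)
proof (induction ws)
  case Nil
  show ?case by (simp add: refl)
next
  case (Cons j ws)
  have "[i, j] @ ws \<approx> [j, i] @ ws"
    using Cons.prems assms(1) by (intro append_right commute') auto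
  also have "\<dots> = [j] @ [i] @ ws" by simp
  also have "[j] @ [i] @ ws \<approx> [j] @ (ws @ [i])"
    using Cons by (intro append_left) auto
  finally show ?case by simp
qed

lemma square_word: "i < N \<Longrightarrow> [i, i] @ ws \<approx> ws"
  using append_right[OF square, of i ws] by simp

text \<open>Conjugation by the cycle s_k ... s_(n-1) lowers the index of a generator by one. The
  letter i commutes past the letters below i - 1, one braid replaces \<open>i, i - 1, i\<close> by
  \<open>i - 1, i, i - 1\<close>, and the last i - 1 commutes past the letters above i.\<close>

lemma ascending_shift:
  assumes "1 \<le> k" "k < i" "i < n" "n \<le> N"
  shows "[i] @ [k..<n] \<approx> [k..<n] @ [i - 1]"
proof -
  define j where "j = i - 1"
  have i: "i = Suc j" "k \<le> j" "0 < j" using assms by (auto simp: j_def)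
  have split: "[k..<n] = [k..<j] @ [j, i] @ [Suc i..<n]"
  proof -
    have "[k..<n] = [k..<j] @ [j..<n]"
      using i assms upt_add_eq_append[of k j "n - j"] by simp
    also have "[j..<n] = j # i # [Suc i..<n]"
      using i assms by (simp add: upt_conv_Cons)
    finally show ?thesis by simp
  qed
  have "([i] @ [k..<j]) @ [j, i] @ [Suc i..<n] \<approx> ([k..<j] @ [i]) @ [j, i] @ [Suc i..<n]"
    using i assms by (intro append_right commute_word) auto
  also have "\<dots> = [k..<j] @ [i, j, i] @ [Suc i..<n]" by simp
  also have "[k..<j] @ [i, j, i] @ [Suc i..<n] \<approx> [k..<j] @ [j, i, j] @ [Suc i..<n]"
    unfolding i(1) using i assms by (intro in_context sym[OF braid]) auto
  also have "\<dots> = ([k..<j] @ [j, i]) @ ([j] @ [Suc i..<n])" by simp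
  also have "([k..<j] @ [j, i]) @ ([j] @ [Suc i..<n]) \<approx> ([k..<j] @ [j, i]) @ ([Suc i..<n] @ [j])"
    using i assms by (intro append_left commute_word) auto
  finally show ?thesis by (simp add: split j_def)
qed

text \<open>The action of a generator on the cosets of B_(n-1), lifted to words. Either the letter
  lengthens or shortens the coset word, or it fixes the coset, travels through the word and leaves
  one letter on the right. That the remainder avoids n - 1 makes an induction on the rank
  possible.\<close>

lemma coset_word_step:
  assumes i: "i < n" and n: "n \<le> N" and k: "k \<in> signed_set n"
  shows "\<exists>ws. set ws \<subseteq> {..<n - 1} \<and> [i] @ coset_word n k \<approx> coset_word n (gen i k) @ ws"
  using k
proof (cases rule: signed_setE)
  case (1 j)
  consider "i = 0" "j = 1" | "0 < i" "Suc i = j" | "i = j" | "Suc i < j" | "j < i" by linarith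
  then show ?thesis
  proof cases
    assume "i = 0" "j = 1"
    then show ?thesis using 1 by (intro exI[of _ "[]"]) (simp add: coset_word_def gen_apply refl)
  next
    assume *: "0 < i" "Suc i = j"
    then have "gen i k = int i" using 1 by (simp add: gen_apply)
    then show ?thesis using 1 * i
      by (intro exI[of _ "[]"]) (simp add: coset_word_pos upt_conv_Cons refl)
  next
    assume *: "i = j"
    then have "gen i k = int (Suc i)" using 1 by (simp add: gen_apply)
    then show ?thesis using 1 * i n square_word[of i "[Suc i..<n]"]
      by (intro exI[of _ "[]"]) (simp only: coset_word_pos, simp add: upt_conv_Cons)
  next
    assume *: "Suc i < j"
    then have "gen i k = k" using 1 by (auto simp: gen_apply)
    then show ?thesis using 1 * i n commute_word[of i "[j..<n]"]
      by (intro exI[of _ "[i]"]) (simp add: coset_word_pos)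
  next
    assume *: "j < i"
    then have "gen i k = k" using 1 by (auto simp: gen_apply)
    then show ?thesis using 1 * i n ascending_shift[of j i n]
      by (intro exI[of _ "[i - 1]"]) (auto simp: coset_word_pos)
  qed
next
  case (2 j)
  let ?u = "[1..<n]"
  consider "i = j" | "Suc i = j" | "j < i" | "Suc i < j" "i = 0" | "Suc i < j" "0 < i" by linarith
  then show ?thesis
  proof cases
    assume *: "i = j"
    then have "gen i k = - int (Suc i)" using 2 by (simp add: gen_apply)
    then show ?thesis using 2 *
      by (intro exI[of _ "[]"]) (simp only: coset_word_neg, simp add: refl)
  next
    assume *: "Suc i = j"
    show ?thesis
    \<comment> \<open>At \<open>i = 0\<close> cancelling the leading 0 changes the coset index from
      -1 to 1, so the result is read from the other branch of \<open>coset_word\<close>.\<close>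
    proof (cases "i = 0")
      case True
      then have j: "k = - int 1" "gen i k = int 1" using 2(3) * by (simp_all add: gen_apply)
      have "[i] @ coset_word n k \<approx> coset_word n (gen i k) @ []"
        unfolding j(2) unfolding j(1) coset_word_neg[OF less_numeral_extra(1)] coset_word_pos[OF less_numeral_extra(1)]
        using square_word[of 0 ?u] i n True by simp
      then show ?thesis by (intro exI[of _ "[]"]) simp
    next
      case False
      then have "gen i k = - int i" using 2 * by (auto simp: gen_apply)
      then show ?thesis using 2(3) i n False square_word[of i "rev [0..<i] @ ?u"] unfolding *[symmetric]
        by (intro exI[of _ "[]"]) (simp only: coset_word_neg zero_less_Suc, simp add: coset_word_neg)
    qed
  next
    assume *: "j < i"
    then have g: "gen i (- int j) = - int j" using 2 by (auto simp: gen_apply)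
    have "([i] @ rev [0..<j]) @ ?u \<approx> (rev [0..<j] @ [i]) @ ?u"
      using * i n by (intro append_right commute_word) auto
    also have "\<dots> = rev [0..<j] @ [i] @ ?u" by simp
    also have "rev [0..<j] @ [i] @ ?u \<approx> rev [0..<j] @ ?u @ [i - 1]"
      using * i n 2 by (intro append_left ascending_shift) auto
    finally show ?thesis using * i 2
      by (intro exI[of _ "[i - 1]"]) (auto simp: g coset_word_neg)
  next
    assume *: "Suc i < j" "i = 0"
    then have g: "gen i (- int j) = - int j" using 2 by (auto simp: gen_apply)
    \<comment> \<open>The letter 0 commutes down to the turning point \<open>1, 0, 1\<close> of the
      coset word; only there does the relation of length four enter.\<close>
    have split: "rev [0..<j] = rev [2..<j] @ [1, 0]"
      using * by (simp add: upt_conv_Cons numeral_2_eq_2)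
    have u: "?u = [1] @ [2..<n]" using * 2 by (simp add: upt_conv_Cons numeral_2_eq_2)
    have "([0] @ rev [2..<j]) @ [1, 0, 1] @ [2..<n] \<approx> (rev [2..<j] @ [0]) @ [1, 0, 1] @ [2..<n]"
      using * 2 n by (intro append_right commute_word) auto
    also have "\<dots> = rev [2..<j] @ [0, 1, 0, 1] @ [2..<n]" by simp
    also have "rev [2..<j] @ [0, 1, 0, 1] @ [2..<n] \<approx> rev [2..<j] @ [1, 0, 1, 0] @ [2..<n]"
      using * 2 n by (intro in_context braid_0) auto
    also have "\<dots> = (rev [2..<j] @ [1, 0, 1]) @ ([0] @ [2..<n])" by simp
    also have "(rev [2..<j] @ [1, 0, 1]) @ ([0] @ [2..<n]) \<approx> (rev [2..<j] @ [1, 0, 1]) @ ([2..<n] @ [0])"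
      using * 2 n by (intro append_left commute_word) auto
    finally have fin: "[0] @ rev [2..<j] @ [1, 0, 1] @ [2..<n] \<approx> (rev [2..<j] @ [1, 0, 1] @ [2..<n]) @ [0]"
      by simp
    have "coset_word n k = rev [2..<j] @ [1, 0, 1] @ [2..<n]"
      using 2 by (simp add: coset_word_neg split u del: upt_conv_Cons One_nat_def)
    moreover have "gen i k = k" using g 2 by simp
    ultimately show ?thesis using fin * 2 by (intro exI[of _ "[0]"]) auto
  next
    assume *: "Suc i < j" "0 < i"
    then have g: "gen i (- int j) = - int j" using 2 by (auto simp: gen_apply)
    let ?h = "rev [Suc (Suc i)..<j]" and ?l = "rev [0..<i]"
    \<comment> \<open>The descending half raises the letter from i to \<open>Suc i\<close> by a
      braid, and the ascending half lowers it again, so the remainder is i.\<close>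
    have split: "rev [0..<j] = ?h @ [Suc i, i] @ ?l"
    proof -
      have "[0..<j] = [0..<i] @ [i..<j]" using * upt_add_eq_append[of 0 i "j - i"] by simp
      also have "[i..<j] = [i, Suc i] @ [Suc (Suc i)..<j]" using * by (simp add: upt_conv_Cons)
      finally show ?thesis by simp
    qed
    have "([i] @ ?h) @ [Suc i, i] @ ?l @ ?u \<approx> (?h @ [i]) @ [Suc i, i] @ ?l @ ?u"
      using * 2 n by (intro append_right commute_word) auto
    also have "\<dots> = ?h @ [i, Suc i, i] @ ?l @ ?u" by simp
    also have "?h @ [i, Suc i, i] @ ?l @ ?u \<approx> ?h @ [Suc i, i, Suc i] @ ?l @ ?u"
      using * 2 n by (intro in_context braid) auto
    also have "\<dots> = (?h @ [Suc i, i]) @ ([Suc i] @ ?l) @ ?u" by simp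
    also have "(?h @ [Suc i, i]) @ ([Suc i] @ ?l) @ ?u \<approx> (?h @ [Suc i, i]) @ (?l @ [Suc i]) @ ?u"
      using * 2 n by (intro in_context commute_word) auto
    also have "\<dots> = (?h @ [Suc i, i] @ ?l) @ ([Suc i] @ ?u)" by simp
    also have "(?h @ [Suc i, i] @ ?l) @ ([Suc i] @ ?u) \<approx> (?h @ [Suc i, i] @ ?l) @ (?u @ [Suc i - 1])"
      using * 2 n by (intro append_left ascending_shift) auto
    finally show ?thesis using * 2
      by (intro exI[of _ "[i]"]) (auto simp: g coset_word_neg split)
  qed
qed

lemma coset_normal_form:
  assumes "n \<le> N" "0 < n" "set ws \<subseteq> {..<n}"
  shows "\<exists>k\<in>signed_set n. \<exists>vs. set vs \<subseteq> {..<n - 1} \<and> ws \<approx> coset_word n k @ vs"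
  using assms(3)
proof (induction ws)
  case Nil
  then show ?case using assms(2) refl
    by (intro bexI[of _ "int n"] exI[of _ "[]"]) (auto simp: coset_word_def signed_set_def)
next
  case (Cons i ws)
  then obtain k vs where k: "k \<in> signed_set n" and vs: "set vs \<subseteq> {..<n - 1}"
    and E: "ws \<approx> coset_word n k @ vs" by auto
  obtain us where us: "set us \<subseteq> {..<n - 1}" "[i] @ coset_word n k \<approx> coset_word n (gen i k) @ us"
    using coset_word_step[of i n k] Cons.prems assms(1) k by auto
  have "[i] @ ws \<approx> [i] @ coset_word n k @ vs" using E by (rule append_left)
  also have "\<dots> = ([i] @ coset_word n k) @ vs" by simp
  also have "([i] @ coset_word n k) @ vs \<approx> (coset_word n (gen i k) @ us) @ vs"
    using us(2) by (rule append_right)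
  finally have "i # ws \<approx> coset_word n (gen i k) @ us @ vs" by simp
  moreover have "gen i k \<in> signed_set n" using gen_signed_set k Cons.prems by auto
  ultimately show ?case using us(1) vs by (metis Un_subset_iff set_append)
qed

text \<open>The image of the largest letter tells which coset word begins the normal form, so two
  words with the same permutation share it. Cancelling it leaves remainders with equal permutations
  over a smaller alphabet. The bound n shrinks in the induction while the congruence keeps its rank
  N.\<close>

theorem perm_eq_imp_congruent:
  assumes "n \<le> N" "set us \<subseteq> {..<n}" "set ws \<subseteq> {..<n}" "word_perm us = word_perm ws"
  shows "us \<approx> ws"
  using assms
proof (induction n arbitrary: us ws)
  case 0
  then show ?case by (simp add: refl)
next
  case (Suc n)
  obtain k us' where us: "k \<in> signed_set (Suc n)" "set us' \<subseteq> {..<n}" "us \<approx> coset_word (Suc n) k @ us'"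
    using coset_normal_form[of "Suc n" us] Suc.prems by auto
  obtain l ws' where ws: "l \<in> signed_set (Suc n)" "set ws' \<subseteq> {..<n}" "ws \<approx> coset_word (Suc n) l @ ws'"
    using coset_normal_form[of "Suc n" ws] Suc.prems by auto
  have pu: "word_perm us = word_perm (coset_word (Suc n) k) \<circ> word_perm us'"
    and pw: "word_perm ws = word_perm (coset_word (Suc n) l) \<circ> word_perm ws'"
    using perm[OF us(3)] perm[OF ws(3)] by simp_all
  have fixes_last: "word_perm us' (int (Suc n)) = int (Suc n)" "word_perm ws' (int (Suc n)) = int (Suc n)"
    using us(2) ws(2) by (auto intro!: word_perm_fixes simp del: of_nat_Suc)
  have "k = word_perm us (int (Suc n))"
    using pu fixes_last word_perm_coset_word[OF us(1)] by simp
  moreover have "l = word_perm ws (int (Suc n))"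
    using pw fixes_last word_perm_coset_word[OF ws(1)] by simp
  ultimately have kl: "k = l" using Suc.prems by simp
  have "word_perm us' = word_perm ws'"
    using pu pw Suc.prems(4) kl by (metis word_perm_left_cancel)
  then have "us' \<approx> ws'" using Suc us(2) ws(2) by simp
  then have "coset_word (Suc n) k @ us' \<approx> coset_word (Suc n) l @ ws'"
    using kl by (simp add: append_left)
  then show ?case using us(3) ws(3) sym trans by blast
qed

end

section \<open>Signed permutations and cosets\<close>

lemma Bgroup_permutes: "g \<in> Bgroup n \<Longrightarrow> g permutes signed_set n"
  by (simp add: Bgroup_def)

lemma Bgroup_minus: "g \<in> Bgroup n \<Longrightarrow> g (- k) = - g k"
  by (simp add: Bgroup_def)

lemma Bgroup_bij: "g \<in> Bgroup n \<Longrightarrow> bij g"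
  using Bgroup_permutes permutes_bij by blast

lemma Bgroup_zero: "g \<in> Bgroup n \<Longrightarrow> g 0 = 0"
  using Bgroup_minus[of g n 0] by simp

lemma id_Bgroup: "id \<in> Bgroup n"
  by (simp add: Bgroup_def permutes_id)

lemma Bgroup_comp: "g \<in> Bgroup n \<Longrightarrow> h \<in> Bgroup n \<Longrightarrow> g \<circ> h \<in> Bgroup n"
  by (auto simp: Bgroup_def permutes_compose)

lemma Bgroup_inv:
  assumes g: "g \<in> Bgroup n" shows "inv g \<in> Bgroup n"
proof -
  have "inv g (- k) = - inv g k" for k
    by (metis Bgroup_bij[OF g] Bgroup_minus[OF g] bij_inv_eq_iff)
  then show ?thesis using g by (simp add: Bgroup_def permutes_inv)
qed

lemma Sgroup_Bgroup: "h \<in> Sgroup n \<Longrightarrow> h \<in> Bgroup n"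
  by (simp add: Sgroup_def)

lemma Sgroup_comp: "g \<in> Sgroup n \<Longrightarrow> h \<in> Sgroup n \<Longrightarrow> g \<circ> h \<in> Sgroup n"
  by (simp add: Sgroup_def Bgroup_comp)

lemma id_Sgroup: "id \<in> Sgroup n"
  by (simp add: Sgroup_def id_Bgroup)

lemma finite_signed_set: "finite (signed_set n)"
  by (rule finite_subset[of _ "{- int n..int n}"]) (auto simp: signed_set_def)

lemma finite_Bgroup: "finite (Bgroup n)"
  by (rule finite_subset[OF _ finite_permutations[OF finite_signed_set[of n]]]) (auto simp: Bgroup_def)

lemma gen_Bgroup: "i < n \<Longrightarrow> gen i \<in> Bgroup n"
proof -
  assume i: "i < n"
  have "gen i permutes signed_set n"
    unfolding permutes_def
  proof (intro conjI allI impI)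
    fix k assume "k \<notin> signed_set n"
    then show "gen i k = k"
      using i by (cases "k = 0") (auto intro!: gen_fixes simp: signed_set_def)
  next
    fix k show "\<exists>!l. gen i l = k" by (metis gen_gen)
  qed
  then show ?thesis by (simp add: Bgroup_def gen_minus)
qed

lemma gen_Sgroup: "0 < i \<Longrightarrow> i < n \<Longrightarrow> gen i \<in> Sgroup n"
  using gen_Bgroup by (auto simp: Sgroup_def gen_pos)

lemma word_perm_Bgroup: "set ws \<subseteq> {..<n} \<Longrightarrow> word_perm ws \<in> Bgroup n"
  by (induction ws) (auto simp: id_Bgroup intro: Bgroup_comp gen_Bgroup)

lemma word_perm_Sgroup: "set ws \<subseteq> {1..<n} \<Longrightarrow> word_perm ws \<in> Sgroup n"
  by (induction ws) (auto simp: id_Sgroup intro!: Sgroup_comp gen_Sgroup)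

lemma Bgroup_fixes_last:
  assumes g: "g \<in> Bgroup (Suc n)" and f: "g (int (Suc n)) = int (Suc n)"
  shows "g \<in> Bgroup n"
proof -
  have "g k = k" if "k \<notin> signed_set n" for k
  proof (cases "k \<in> signed_set (Suc n)")
    case True
    then have "k = int (Suc n) \<or> k = - int (Suc n)" using that by (auto simp: signed_set_def)
    then show ?thesis using f Bgroup_minus[OF g, of "int (Suc n)"] by metis
  next
    case False
    then show ?thesis using Bgroup_permutes[OF g] by (simp add: permutes_not_in)
  qed
  then show ?thesis using g by (auto simp: Bgroup_def permutes_def)
qed

text \<open>One induction serves both groups: for an element of S_n the coset index is positive, its
  coset word avoids the letter 0, and the cofactor stays in S_n.\<close>

lemma Bgroup_word:
  "g \<in> Bgroup n \<Longrightarrow> \<exists>ws. set ws \<subseteq> {..<n} \<and> word_perm ws = g \<and> (g \<in> Sgroup n \<longrightarrow> 0 \<notin> set ws)"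
proof (induction n arbitrary: g)
  case 0
  then have "g = id" by (auto simp: Bgroup_def signed_set_def permutes_def)
  then show ?case by (intro exI[of _ "[]"]) simp
next
  case (Suc n)
  define k where "k = g (int (Suc n))"
  let ?u = "coset_word (Suc n) k"
  have k: "k \<in> signed_set (Suc n)"
    using Suc.prems permutes_in_image[OF Bgroup_permutes] by (fastforce simp: k_def signed_set_def)
  have u: "set ?u \<subseteq> {..<Suc n}" "word_perm ?u (int (Suc n)) = k"
    using set_coset_word[OF k] word_perm_coset_word[OF k] by auto
  define h where "h = word_perm (rev ?u) \<circ> g"
  have gh: "g = word_perm ?u \<circ> h"
    unfolding h_def by (simp add: comp_assoc[symmetric] word_perm_comp_rev)
  have hB: "h \<in> Bgroup (Suc n)" unfolding h_def
    using u(1) Suc.prems by (intro Bgroup_comp word_perm_Bgroup) auto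
  have "h (int (Suc n)) = word_perm (rev ?u) k" by (simp add: h_def k_def)
  also have "\<dots> = (word_perm (rev ?u) \<circ> word_perm ?u) (int (Suc n))" using u(2) by simp
  also have "\<dots> = int (Suc n)" by (simp only: word_perm_rev_comp id_apply)
  finally have hn: "h \<in> Bgroup n" using hB Bgroup_fixes_last by blast
  obtain ws where ws: "set ws \<subseteq> {..<n}" "word_perm ws = h" "h \<in> Sgroup n \<longrightarrow> 0 \<notin> set ws"
    using Suc.IH[OF hn] by blast
  show ?case
  proof (intro exI[of _ "?u @ ws"] conjI impI)
    show "set (?u @ ws) \<subseteq> {..<Suc n}" using u(1) ws(1) by auto
    show "word_perm (?u @ ws) = g" using gh ws(2) by simp
    assume g: "g \<in> Sgroup (Suc n)"
    then have "k > 0" by (simp add: k_def Sgroup_def)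
    then have u0: "set ?u \<subseteq> {1..<Suc n}" by (auto simp: coset_word_def)
    then have "h \<in> Sgroup (Suc n)" unfolding h_def
      using g by (intro Sgroup_comp word_perm_Sgroup) auto
    then have "h \<in> Sgroup n" using hn by (simp add: Sgroup_def)
    then show "0 \<notin> set (?u @ ws)" using ws(3) u0 by auto
  qed
qed

lemma Sgroup_word: "g \<in> Sgroup n \<Longrightarrow> \<exists>ws. set ws \<subseteq> {1..<n} \<and> word_perm ws = g"
proof -
  assume g: "g \<in> Sgroup n"
  then obtain ws where ws: "set ws \<subseteq> {..<n}" "word_perm ws = g" "0 \<notin> set ws"
    using Bgroup_word[OF Sgroup_Bgroup[OF g]] by blast
  have "i \<in> {1..<n}" if "i \<in> set ws" for i using ws that by (cases i) auto
  then show ?thesis using ws(2) by blast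
qed

text \<open>Cosets of \<open>S\<^sub>n\<close> in \<open>B\<^sub>n\<close> correspond to the possible images of \<open>{1..n}\<close>.\<close>

lemma Sgroup_iff_image:
  assumes g: "g \<in> Bgroup n"
  shows "g \<in> Sgroup n \<longleftrightarrow> g ` {1..int n} = {1..int n}"
proof
  assume "g \<in> Sgroup n"
  then have pos: "\<And>k. k > 0 \<Longrightarrow> g k > 0" by (simp add: Sgroup_def)
  have "g ` {1..int n} \<subseteq> {1..int n}"
  proof (clarify)
    fix k :: int assume k: "k \<in> {1..int n}"
    then have "g k \<in> signed_set n"
      using permutes_in_image[OF Bgroup_permutes[OF g], of k] by (auto simp: signed_set_def)
    then show "g k \<in> {1..int n}" using pos[of k] k by (auto simp: signed_set_def)
  qed
  moreover have "inj_on g {1..int n}" using Bgroup_bij[OF g] by (meson bij_is_inj inj_on_subset subset_UNIV)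
  ultimately show "g ` {1..int n} = {1..int n}"
    by (simp add: endo_inj_surj)
next
  assume im: "g ` {1..int n} = {1..int n}"
  have "g k > 0" if "k > 0" for k
  proof (cases "k \<le> int n")
    case True
    then have "g k \<in> {1..int n}" using im that by force
    then show ?thesis by simp
  next
    case False
    then have "g k = k" using permutes_not_in[OF Bgroup_permutes[OF g]] that by (auto simp: signed_set_def)
    then show ?thesis using that by simp
  qed
  then show "g \<in> Sgroup n" using g by (simp add: Sgroup_def)
qed

lemma inv_comp_Sgroup_iff:
  assumes "g \<in> Bgroup n" "h \<in> Bgroup n"
  shows "inv g \<circ> h \<in> Sgroup n \<longleftrightarrow> g ` {1..int n} = h ` {1..int n}"
proof -
  have "inv g \<circ> h \<in> Sgroup n \<longleftrightarrow> inv g ` (h ` {1..int n}) = {1..int n}"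
    using Sgroup_iff_image[OF Bgroup_comp[OF Bgroup_inv[OF assms(1)] assms(2)]] by (simp add: image_comp)
  also have "\<dots> \<longleftrightarrow> g ` {1..int n} = h ` {1..int n}"
    using Bgroup_bij[OF assms(1)]
    by (metis bij_is_inj bij_is_surj image_inv_f_f image_f_inv_f)
  finally show ?thesis .
qed

text \<open>The representative is an arbitrary choice; what matters is its coset, which is recorded
  by the image of \<open>{1..int n}\<close>.\<close>

lemma coset_representative:
  assumes g: "g \<in> Bgroup n"
  defines "r \<equiv> (SOME r. r \<in> (\<lambda>h. g \<circ> h) ` Sgroup n)"
  shows "r \<in> Bgroup n" "r ` {1..int n} = g ` {1..int n}"
proof -
  have "g \<circ> id \<in> (\<lambda>h. g \<circ> h) ` Sgroup n" by (intro imageI id_Sgroup)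
  then have "r \<in> (\<lambda>h. g \<circ> h) ` Sgroup n" unfolding r_def by (rule someI[of "\<lambda>r. r \<in> _"])
  then obtain h where h: "h \<in> Sgroup n" "r = g \<circ> h" by blast
  then show "r \<in> Bgroup n" using g by (auto intro: Bgroup_comp Sgroup_Bgroup)
  have "r ` {1..int n} = g ` (h ` {1..int n})" unfolding h(2) by (simp only: image_comp)
  then show "r ` {1..int n} = g ` {1..int n}"
    using h Sgroup_iff_image[OF Sgroup_Bgroup[OF h(1)]] by simp
qed

lemma transversalE:
  assumes "r \<in> transversal (Bgroup n) (Sgroup n)"
  obtains g where "g \<in> Bgroup n" "r = (SOME r. r \<in> (\<lambda>h. g \<circ> h) ` Sgroup n)"
  using assms by (auto simp: transversal_def)

lemma transversal_Bgroup: "r \<in> transversal (Bgroup n) (Sgroup n) \<Longrightarrow> r \<in> Bgroup n"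
  using coset_representative(1) by (metis transversalE)

lemma coset_subsetI:
  assumes g: "g \<in> Bgroup n" and h: "h \<in> Bgroup n" and im: "g ` {1..int n} = h ` {1..int n}"
  shows "(\<lambda>s. g \<circ> s) ` Sgroup n \<subseteq> (\<lambda>s. h \<circ> s) ` Sgroup n"
proof clarify
  fix s assume s: "s \<in> Sgroup n"
  have "inv h \<circ> g \<in> Sgroup n" using inv_comp_Sgroup_iff[OF h g] im by simp
  then have "(inv h \<circ> g) \<circ> s \<in> Sgroup n" using s by (rule Sgroup_comp)
  moreover have "h \<circ> ((inv h \<circ> g) \<circ> s) = g \<circ> s"
    using Bgroup_bij[OF h] by (simp add: fun_eq_iff bij_is_surj surj_f_inv_f)
  ultimately show "g \<circ> s \<in> (\<lambda>s. h \<circ> s) ` Sgroup n" by (metis imageI)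
qed

lemma transversal_image_eq:
  assumes r: "r \<in> transversal (Bgroup n) (Sgroup n)" and r': "r' \<in> transversal (Bgroup n) (Sgroup n)"
    and im: "r ` {1..int n} = r' ` {1..int n}"
  shows "r = r'"
proof -
  obtain g where g: "g \<in> Bgroup n" "r = (SOME r. r \<in> (\<lambda>h. g \<circ> h) ` Sgroup n)"
    using r by (rule transversalE)
  obtain g' where g': "g' \<in> Bgroup n" "r' = (SOME r. r \<in> (\<lambda>h. g' \<circ> h) ` Sgroup n)"
    using r' by (rule transversalE)
  have "g ` {1..int n} = g' ` {1..int n}"
    using im coset_representative(2)[OF g(1)] coset_representative(2)[OF g'(1)] g(2) g'(2) by simp
  then have "(\<lambda>h. g \<circ> h) ` Sgroup n = (\<lambda>h. g' \<circ> h) ` Sgroup n"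
    using coset_subsetI[OF g(1) g'(1)] coset_subsetI[OF g'(1) g(1)] by (intro equalityI) auto
  then show ?thesis using g(2) g'(2) by simp
qed

lemma transversal_ex:
  assumes g: "g \<in> Bgroup n"
  obtains r where "r \<in> transversal (Bgroup n) (Sgroup n)" "r ` {1..int n} = g ` {1..int n}"
  using that[of "SOME r. r \<in> (\<lambda>h. g \<circ> h) ` Sgroup n"] coset_representative(2)[OF g] g
  unfolding transversal_def by blast

lemma finite_transversal: "finite (transversal (Bgroup n) (Sgroup n))"
  using finite_subset[OF _ finite_Bgroup] transversal_Bgroup by blast

section \<open>Seminormal operators and tableaux\<close>

text \<open>A generator acting on coefficient functions, so the value at \<open>x\<close> collects
  row \<open>x\<close> of its matrix. The matrix entry in column \<open>s x\<close> carries
  \<open>f (s x)\<close>; the two agree because \<open>f\<close> changes sign under \<open>s\<close>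
  and occurs squared.\<close>

definition seminormal :: "('x \<Rightarrow> real) \<Rightarrow> ('x \<Rightarrow> 'x) \<Rightarrow> ('x \<Rightarrow> real) \<Rightarrow> 'x \<Rightarrow> real" where
  "seminormal f s v x = 1 / f x * v x + sqrt (1 - 1 / (f x)\<^sup>2) * v (s x)"

lemma one_le_square: "1 \<le> \<bar>p::real\<bar> \<Longrightarrow> 1 \<le> p\<^sup>2"
  by (metis abs_le_square_iff abs_one one_power2)

lemma sqrt_sq:
  fixes p :: real
  assumes "1 \<le> \<bar>p\<bar>"
  shows "sqrt (1 - 1 / p\<^sup>2) * sqrt (1 - 1 / p\<^sup>2) = 1 - 1 / p * (1 / p)"
proof -
  have "1 / p\<^sup>2 \<le> 1" using one_le_square[OF assms] by (simp add: divide_le_eq)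
  then show ?thesis by (simp add: power2_eq_square)
qed

lemma seminormal_square:
  assumes "f (s x) = - f x" "s (s x) = x" "1 \<le> \<bar>f x\<bar>"
  shows "seminormal f s (seminormal f s v) x = v x"
proof -
  define A where "A = 1 / f x"
  define B where "B = sqrt (1 - 1 / (f x)\<^sup>2)"
  have "B * B = 1 - A * A" unfolding A_def B_def by (rule sqrt_sq[OF assms(3)])
  then have "A * (A * v x + B * v (s x)) + B * ((- A) * v (s x) + B * v x) = v x" by Groebner_Basis.algebra
  then show ?thesis using assms(1,2) by (simp add: seminormal_def A_def B_def)
qed

lemma seminormal_commute:
  assumes "f (t x) = f x" "g (s x) = g x" "s (t x) = t (s x)"
  shows "seminormal f s (seminormal g t v) x = seminormal g t (seminormal f s v) x"
  using assms by (simp add: seminormal_def algebra_simps)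

text \<open>Here \<open>f\<close> and \<open>g\<close> transform like the simple roots of type A2
  under the reflections \<open>s\<close> and \<open>t\<close>, with positive root values p, q, p + q
  at \<open>x\<close>. The relation rests on 1/(pq) = (1/p + 1/q)/(p + q) and on the squares of the
  roots belonging to p and q; the one belonging to p + q enters linearly.\<close>

lemma seminormal_braid:
  assumes Y: "\<And>y. y \<in> Y \<Longrightarrow> s y \<in> Y" "\<And>y. y \<in> Y \<Longrightarrow> t y \<in> Y"
    and inv: "\<And>y. s (s y) = y" "\<And>y. t (t y) = y" and st: "s (t (s x)) = t (s (t x))"
    and s: "\<And>y. y \<in> Y \<Longrightarrow> f (s y) = - f y" "\<And>y. y \<in> Y \<Longrightarrow> g (s y) = f y + g y"
    and t: "\<And>y. y \<in> Y \<Longrightarrow> g (t y) = - g y" "\<And>y. y \<in> Y \<Longrightarrow> f (t y) = f y + g y"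
    and x: "x \<in> Y" "1 \<le> \<bar>f x\<bar>" "1 \<le> \<bar>g x\<bar>" "f x + g x \<noteq> 0"
  shows "seminormal f s (seminormal g t (seminormal f s v)) x
       = seminormal g t (seminormal f s (seminormal g t v)) x"
proof -
  define p q where "p = f x" and "q = g x"
  have nz: "p \<noteq> 0" "q \<noteq> 0" "p + q \<noteq> 0" using x by (auto simp: p_def q_def)
  have vals: "f x = p" "g x = q" "f (s x) = - p" "g (s x) = p + q" "f (t x) = p + q" "g (t x) = - q"
    "f (t (s x)) = q" "g (s (t x)) = p"
    using x(1) Y s t by (simp_all add: p_def q_def)
  define A C G where "A = 1 / p" and "C = 1 / q" and "G = 1 / (p + q)"
  define P Q R where "P = sqrt (1 - 1 / p\<^sup>2)" and "Q = sqrt (1 - 1 / q\<^sup>2)" and "R = sqrt (1 - 1 / (p + q)\<^sup>2)"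
  have rel: "A * C = G * (A + C)"
    using nz by (simp add: A_def C_def G_def divide_simps)
  have sq: "P * P = 1 - A * A" "Q * Q = 1 - C * C"
    unfolding A_def C_def P_def Q_def by (rule x(2,3)[THEN sqrt_sq, unfolded vals])+
  have coeffs: "1 / p = A" "1 / - p = - A" "1 / q = C" "1 / - q = - C" "1 / (p + q) = G"
    "sqrt (1 - 1 / p\<^sup>2) = P" "sqrt (1 - 1 / q\<^sup>2) = Q" "sqrt (1 - 1 / (p + q)\<^sup>2) = R"
    by (simp_all add: A_def C_def G_def P_def Q_def R_def)
  have "A * (C * (A * a + P * b) + Q * (G * c + R * d)) + P * (G * (- A * b + P * a) + R * (C * e + Q * h))
      = C * (A * (C * a + Q * c) + P * (G * b + R * e)) + Q * (G * (- C * c + Q * a) + R * (A * d + P * h))"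
    for a b c d e h
    using rel sq by Groebner_Basis.algebra
  then show ?thesis
    by (simp only: seminormal_def vals inv st power2_minus coeffs)
qed

text \<open>The analogue in type B2, with positive root values p, q, p + q, p + 2q. The factor 2
  reflects that the denominator of s_0 is twice a content, a long root. \<open>rel\<close> lists the
  partial fraction identities coming from the linear dependencies between these four values.\<close>

lemma seminormal_braid4:
  assumes Y: "\<And>y. y \<in> Y \<Longrightarrow> s y \<in> Y" "\<And>y. y \<in> Y \<Longrightarrow> t y \<in> Y"
    and inv: "\<And>y. s (s y) = y" "\<And>y. t (t y) = y" and st: "t (s (t (s x))) = s (t (s (t x)))"
    and s: "\<And>y. y \<in> Y \<Longrightarrow> f (s y) = - f y" "\<And>y. y \<in> Y \<Longrightarrow> g (s y) = f y + g y"
    and t: "\<And>y. y \<in> Y \<Longrightarrow> g (t y) = - g y" "\<And>y. y \<in> Y \<Longrightarrow> f (t y) = f y + 2 * g y"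
    and x: "x \<in> Y" "1 \<le> \<bar>f x\<bar>" "1 \<le> \<bar>g x\<bar>" "1 \<le> \<bar>f x + g x\<bar>" "1 \<le> \<bar>f x + 2 * g x\<bar>"
  shows "seminormal f s (seminormal g t (seminormal f s (seminormal g t v))) x
       = seminormal g t (seminormal f s (seminormal g t (seminormal f s v))) x"
proof -
  define p q where "p = f x" and "q = g x"
  have nz: "p \<noteq> 0" "q \<noteq> 0" "p + q \<noteq> 0" "p + 2 * q \<noteq> 0" using x by (auto simp: p_def q_def)
  have vals: "f x = p" "g x = q" "f (s x) = - p" "g (s x) = p + q" "f (t x) = p + 2 * q" "g (t x) = - q"
    "f (t (s x)) = p + 2 * q" "g (t (s x)) = - (p + q)" "f (s (t x)) = - (p + 2 * q)" "g (s (t x)) = p + q"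
    "g (s (t (s x))) = q" "f (t (s (t x))) = p"
    using x(1) Y s t by (simp_all add: p_def q_def)
  define A C G H where "A = 1 / p" and "C = 1 / q" and "G = 1 / (p + q)" and "H = 1 / (p + 2 * q)"
  define P Q R S where "P = sqrt (1 - 1 / p\<^sup>2)" and "Q = sqrt (1 - 1 / q\<^sup>2)"
    and "R = sqrt (1 - 1 / (p + q)\<^sup>2)" and "S = sqrt (1 - 1 / (p + 2 * q)\<^sup>2)"
  have rel: "A * C = G * (A + C)" "G * C = H * (C + G)" "2 * (A * H) = G * (A + H)" "2 * (A * H) = C * (A - H)"
    using nz by (simp_all add: A_def C_def G_def H_def divide_simps)
  have sq: "P * P = 1 - A * A" "Q * Q = 1 - C * C" "R * R = 1 - G * G" "S * S = 1 - H * H"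
    unfolding A_def C_def G_def H_def P_def Q_def R_def S_def
    by (rule x(2-5)[THEN sqrt_sq, unfolded vals])+
  have neg: "1 / - a = - (1 / a)" for a :: real by simp
  have coeffs: "1 / p = A" "1 / - p = - A" "1 / q = C" "1 / - q = - C" "1 / (p + q) = G" "1 / - (p + q) = - G"
    "1 / (p + 2 * q) = H" "1 / - (p + 2 * q) = - H"
    "sqrt (1 - 1 / p\<^sup>2) = P" "sqrt (1 - 1 / q\<^sup>2) = Q" "sqrt (1 - 1 / (p + q)\<^sup>2) = R"
    "sqrt (1 - 1 / (p + 2 * q)\<^sup>2) = S"
    unfolding A_def C_def G_def H_def P_def Q_def R_def S_def by (rule HOL.refl neg)+
  \<comment> \<open>The eight variables stand for the values of \<open>v\<close> at the points that
    words in \<open>s\<close> and \<open>t\<close> reach from \<open>x\<close>, one for each element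
    of the dihedral group of order eight.\<close>
  have "A * (C * (A * (C * a + Q * b) + P * (G * c + R * d)) + Q * (H * (- C * b + Q * a) + S * (G * e + R * k)))
      + P * (G * (- A * (G * c + R * d) + P * (C * a + Q * b)) + R * (H * (- G * d + R * c) + S * (C * l + Q * w)))
    = C * (A * (C * (A * a + P * c) + Q * (H * b + S * e)) + P * (G * (- A * c + P * a) + R * (H * d + S * l)))
      + Q * (H * (- C * (H * b + S * e) + Q * (A * a + P * c)) + S * (G * (- H * e + S * b) + R * (A * k + P * w)))"
    for a b c d e k l w
    using rel sq by Groebner_Basis.algebra
  then show ?thesis
    by (simp only: seminormal_def vals inv st power2_minus coeffs)
qed

section \<open>Convexity of skew shapes and entries along a diagonal\<close>

lemma skew_shape_finite: "skew_shape D \<Longrightarrow> finite D"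
  by (auto simp: skew_shape_def partition_diagram_def)

text \<open>Membership in \<open>L\<close> is inherited from the lower right corner, absence from
  \<open>M\<close> from the upper left one.\<close>

lemma skew_shape_convex:
  assumes "skew_shape D" "(r, j) \<in> D" "(r', j') \<in> D" "r \<le> a" "a \<le> r'" "j \<le> b" "b \<le> j'"
  shows "(a, b) \<in> D"
proof -
  obtain L M where LM: "partition_diagram L" "partition_diagram M" "D = L - M"
    using assms(1) by (auto simp: skew_shape_def)
  have pos: "1 \<le> r" "1 \<le> j" using LM assms(2) by (auto simp: partition_diagram_def)
  have "(a, b) \<in> L" using LM assms pos unfolding partition_diagram_def by (smt (verit) DiffD1)
  moreover have "(a, b) \<notin> M" using LM assms pos unfolding partition_diagram_def by (smt (verit) DiffD2)
  ultimately show ?thesis using LM by simp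
qed

lemma standard_row: "standard D T \<Longrightarrow> (r, j) \<in> D \<Longrightarrow> (r, j') \<in> D \<Longrightarrow> j < j' \<Longrightarrow> T (r, j) < T (r, j')"
  by (auto simp: standard_def)

lemma standard_col: "standard D T \<Longrightarrow> (r, j) \<in> D \<Longrightarrow> (r', j) \<in> D \<Longrightarrow> r < r' \<Longrightarrow> T (r, j) < T (r', j)"
  by (auto simp: standard_def)

lemma standard_less:
  assumes D: "skew_shape D" and T: "standard D T"
    and b: "(r, j) \<in> D" "(r', j') \<in> D" "r \<le> r'" "j \<le> j'" "(r, j) \<noteq> (r', j')"
  shows "T (r, j) < T (r', j')"
proof -
  have c: "(r, j') \<in> D" using skew_shape_convex[OF D b(1,2)] b by auto
  have "T (r, j) \<le> T (r, j')" using standard_row[OF T b(1) c] b(4) by (cases "j = j'") auto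
  moreover have "T (r, j') \<le> T (r', j')" using standard_col[OF T c b(2)] b(3) by (cases "r = r'") auto
  moreover have "T (r, j) \<noteq> T (r, j') \<or> T (r, j') \<noteq> T (r', j')"
    using b standard_row[OF T b(1) c] standard_col[OF T c b(2)] by (cases "j = j'"; cases "r = r'") auto
  ultimately show ?thesis by linarith
qed

text \<open>By convexity the right and lower neighbours of the upper box both belong to the shape,
  and standardness forces their entries strictly between. Hence entries of equal content are at
  least three apart.\<close>

lemma standard_same_content:
  assumes D: "skew_shape D" and T: "standard D T"
    and b: "b \<in> D" "b' \<in> D" "content b = content b'" "T b < T b'"
  shows "\<exists>x\<in>D. \<exists>y\<in>D. x \<noteq> y \<and> T b < T x \<and> T x < T b' \<and> T b < T y \<and> T y < T b'"
proof -
  obtain r j where bb: "b = (r, j)" by (cases b)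
  obtain r' j' where bb': "b' = (r', j')" by (cases b')
  have d: "r' - r = j' - j" using b(3) by (simp add: content_def bb bb')
  have "r < r'"
  proof (rule ccontr)
    assume "\<not> r < r'"
    then have "r' \<le> r" "j' \<le> j" using d by auto
    then have "b = b' \<or> T b' < T b" using standard_less[OF D T, of r' j' r j] b(1,2) unfolding bb bb' by blast
    then show False using b(4) by auto
  qed
  then have le: "r + 1 \<le> r'" "j + 1 \<le> j'" using d by auto
  have x: "(r + 1, j) \<in> D" "(r, j + 1) \<in> D"
    using skew_shape_convex[OF D, of r j r' j'] b(1,2) le by (auto simp: bb bb')
  have "T (r, j) < T (r + 1, j)" "T (r, j) < T (r, j + 1)" "T (r + 1, j) < T (r', j')" "T (r, j + 1) < T (r', j')"
    using b(1,2) le x by (auto simp: bb bb' intro!: standard_less[OF D T])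
  then show ?thesis using x by (intro bexI[of _ "(r + 1, j)"] bexI[of _ "(r, j + 1)"]) (auto simp: bb bb')
qed

text \<open>Fillings that are not necessarily standard, on which \<open>B\<^sub>n\<close> acts by relabelling.\<close>

definition signed_fillings :: "box set \<Rightarrow> nat \<Rightarrow> filling set" where
  "signed_fillings D n = {T. inj_on T D \<and> T ` D \<subseteq> signed_set n \<and> (\<forall>b. b \<notin> D \<longrightarrow> T b = 0) \<and>
      (\<forall>k\<in>signed_set n. k \<in> T ` D \<longleftrightarrow> - k \<notin> T ` D)}"

lemma Btab_eq: "Btab D m n = {T \<in> signed_fillings D n. standard D T}"
proof -
  have "(\<forall>k::int. 1 \<le> k \<and> k \<le> int n \<longrightarrow> (k \<in> S \<longleftrightarrow> - k \<notin> S)) \<longleftrightarrow> (\<forall>k\<in>signed_set n. k \<in> S \<longleftrightarrow> - k \<notin> S)" for S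
    unfolding signed_set_def by (smt (verit, best) mem_Collect_eq minus_minus)
  then show ?thesis by (auto simp: Btab_def signed_fillings_def)
qed

lemma signed_set_minus: "- k \<in> signed_set n \<longleftrightarrow> k \<in> signed_set n"
  by (auto simp: signed_set_def)

lemma act_act: "act \<pi> (act \<tau> T) = act (\<pi> \<circ> \<tau>) T"
  by (simp add: act_def)

lemma act_gen_gen [simp]: "act (gen i) (act (gen i) T) = T"
  by (simp add: act_def)

lemma act_signed_fillings:
  assumes g: "g \<in> Bgroup n" and T: "T \<in> signed_fillings D n"
  shows "act g T \<in> signed_fillings D n"
proof -
  have b: "bij g" and p: "g permutes signed_set n" using g Bgroup_bij Bgroup_permutes by auto
  have im: "act g T ` D = g ` T ` D" by (auto simp: act_def)
  have mem: "g k \<in> g ` T ` D \<longleftrightarrow> k \<in> T ` D" for k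
    using b by (meson bij_is_inj inj_image_mem_iff)
  have "inj_on (act g T) D"
    using T bij_is_inj[OF b] by (auto simp: signed_fillings_def act_def inj_on_def)
  moreover have "act g T ` D \<subseteq> signed_set n"
    unfolding im using T permutes_image[OF p] by (auto simp: signed_fillings_def)
  moreover have "\<forall>k\<in>signed_set n. k \<in> act g T ` D \<longleftrightarrow> - k \<notin> act g T ` D"
  proof
    fix k assume "k \<in> signed_set n"
    then obtain l where l: "l \<in> signed_set n" "k = g l" using permutes_image[OF p] by auto
    then show "k \<in> act g T ` D \<longleftrightarrow> - k \<notin> act g T ` D"
      using T mem unfolding im by (simp add: signed_fillings_def flip: Bgroup_minus[OF g])
  qed
  ultimately show ?thesis using T Bgroup_zero[OF g] by (auto simp: signed_fillings_def act_def)
qed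

lemma box_of_eq: "T \<in> signed_fillings D n \<Longrightarrow> b \<in> D \<Longrightarrow> box_of D T (T b) = b"
  unfolding box_of_def signed_fillings_def by (auto dest: inj_onD)

lemma entry_signed_set: "T \<in> signed_fillings D n \<Longrightarrow> b \<in> D \<Longrightarrow> T b \<in> signed_set n"
  by (auto simp: signed_fillings_def)

lemma minus_entry: "T \<in> signed_fillings D n \<Longrightarrow> b \<in> D \<Longrightarrow> - T b \<notin> T ` D"
  using entry_signed_set[of T D n b] unfolding signed_fillings_def by blast

lemma entry_cases:
  assumes "T \<in> signed_fillings D n" "k \<in> signed_set n"
  obtains b where "b \<in> D" "k = T b" | b where "b \<in> D" "k = - T b"
  using assms unfolding signed_fillings_def by force

lemma bcv_entry:
  assumes "T \<in> signed_fillings D n" "b \<in> D"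
  shows "bcv D m T (T b) = bcontent D m b" "bcv D m T (- T b) = - bcontent D m b"
  using assms minus_entry[OF assms] by (auto simp: bcv_def box_of_eq)

lemma bcv_minus:
  assumes "T \<in> signed_fillings D n" "k \<in> signed_set n"
  shows "bcv D m T (- k) = - bcv D m T k"
  using assms by (rule entry_cases) (use bcv_entry[OF assms(1)] in auto)

lemma bcv_act:
  assumes T: "T \<in> signed_fillings D n" and k: "k \<in> signed_set n" and g: "g \<in> Bgroup n"
  shows "bcv D m (act g T) (g k) = bcv D m T k"
  using T k
proof (rule entry_cases)
  fix b assume b: "b \<in> D" "k = T b"
  then show ?thesis using bcv_entry[OF T b(1)] bcv_entry[OF act_signed_fillings[OF g T] b(1)] by (simp add: act_def)
next
  fix b assume b: "b \<in> D" "k = - T b"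
  then show ?thesis using bcv_entry[OF T b(1)] bcv_entry[OF act_signed_fillings[OF g T] b(1)]
    by (simp add: act_def Bgroup_minus[OF g])
qed

lemma bcv_act_gen:
  assumes "T \<in> signed_fillings D n" "i < n" "k \<in> signed_set n"
  shows "bcv D m (act (gen i) T) k = bcv D m T (gen i k)"
  using bcv_act[OF assms(1) gen_signed_set[OF assms(2,3)] gen_Bgroup[OF assms(2)]] by simp

text \<open>Contents belong to boxes and relabelling only moves entries, so the content vector is
  equivariant and \<open>fvec\<close> changes as the simple roots 2e_1, e_2 - e_1, e_3 - e_2, ... do
  under simple reflections. The coefficient 2 in the last claim comes from 2e_2 = 2e_1 + 2(e_2 -
  e_1).\<close>

lemma fvec_act_gen:
  assumes T: "T \<in> signed_fillings D n" and i: "i < n"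
  shows "fvec D m (act (gen i) T) i = - fvec D m T i"
    and "j < n \<Longrightarrow> i + 1 < j \<or> j + 1 < i \<Longrightarrow> fvec D m (act (gen i) T) j = fvec D m T j"
    and "0 < i \<Longrightarrow> Suc i < n \<Longrightarrow> fvec D m (act (gen i) T) (Suc i) = fvec D m T i + fvec D m T (Suc i)"
    and "0 < j \<Longrightarrow> i = Suc j \<Longrightarrow> fvec D m (act (gen i) T) j = fvec D m T j + fvec D m T i"
    and "i = 0 \<Longrightarrow> 1 < n \<Longrightarrow> fvec D m (act (gen i) T) 1 = fvec D m T 0 + fvec D m T 1"
    and "i = 1 \<Longrightarrow> fvec D m (act (gen i) T) 0 = fvec D m T 0 + 2 * fvec D m T 1"
proof -
  note act = bcv_act_gen[OF T]
  have one: "1 \<in> signed_set n" using i by (simp add: signed_set_def)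
  show "fvec D m (act (gen i) T) i = - fvec D m T i"
    using i by (auto simp: fvec_def act signed_set_def gen_apply bcv_minus[OF T one])
  show "j < n \<Longrightarrow> i + 1 < j \<or> j + 1 < i \<Longrightarrow> fvec D m (act (gen i) T) j = fvec D m T j"
    using i by (auto simp: fvec_def act signed_set_def gen_fixes)
  show "0 < i \<Longrightarrow> Suc i < n \<Longrightarrow> fvec D m (act (gen i) T) (Suc i) = fvec D m T i + fvec D m T (Suc i)"
    by (auto simp: fvec_def act signed_set_def gen_pos add.commute)
  show "0 < j \<Longrightarrow> i = Suc j \<Longrightarrow> fvec D m (act (gen i) T) j = fvec D m T j + fvec D m T i"
    using i by (auto simp: fvec_def act signed_set_def gen_pos add.commute)
  show "i = 0 \<Longrightarrow> 1 < n \<Longrightarrow> fvec D m (act (gen i) T) 1 = fvec D m T 0 + fvec D m T 1"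
    using bcv_minus[OF T one, of m] by (auto simp: fvec_def act signed_set_def gen_apply)
  show "i = 1 \<Longrightarrow> fvec D m (act (gen i) T) 0 = fvec D m T 0 + 2 * fvec D m T 1"
    using i by (auto simp: fvec_def act signed_set_def gen_pos add.commute)
qed

section \<open>Products of matrices along words\<close>

lemma word_mat_Nil: "word_mat X M [] = mat_id"
  by (simp add: word_mat_def)

lemma word_mat_Cons: "word_mat X M (i # ws) a c = (\<Sum>b\<in>X. M i a b * word_mat X M ws b c)"
  by (simp add: word_mat_def mat_mult_def)

lemma sum_mat_id:
  assumes "finite X" "a \<in> X"
  shows "(\<Sum>b\<in>X. mat_id a b * v b) = v a" "(\<Sum>b\<in>X. v b * mat_id b a) = v a"
proof -
  have "(\<Sum>b\<in>X. mat_id a b * v b) = (\<Sum>b\<in>X. if a = b then v b else 0)"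
    by (intro sum.cong) (auto simp: mat_id_def)
  then show "(\<Sum>b\<in>X. mat_id a b * v b) = v a" using assms by simp
  have "(\<Sum>b\<in>X. v b * mat_id b a) = (\<Sum>b\<in>X. if b = a then v b else 0)"
    by (intro sum.cong) (auto simp: mat_id_def)
  then show "(\<Sum>b\<in>X. v b * mat_id b a) = v a" using assms by simp
qed

lemma sum_mat_assoc:
  fixes A :: "'b \<Rightarrow> real"
  shows "(\<Sum>b\<in>X. A b * (\<Sum>c\<in>Y. B b c * C c)) = (\<Sum>c\<in>Y. (\<Sum>b\<in>X. A b * B b c) * C c)"
  by (simp only: sum_distrib_left sum_distrib_right mult.assoc) (rule sum.swap)

lemma word_mat_append:
  assumes "finite X" "a \<in> X"
  shows "word_mat X M (us @ ws) a c = (\<Sum>b\<in>X. word_mat X M us a b * word_mat X M ws b c)"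
  using assms(2)
proof (induction us arbitrary: a)
  case Nil
  then show ?case using assms(1) by (simp add: word_mat_Nil sum_mat_id)
next
  case (Cons i us)
  then have "word_mat X M ((i # us) @ ws) a c
      = (\<Sum>b\<in>X. M i a b * (\<Sum>d\<in>X. word_mat X M us b d * word_mat X M ws d c))"
    by (simp add: word_mat_Cons)
  then show ?case by (simp add: sum_mat_assoc word_mat_Cons)
qed

section \<open>Half-integral contents and lower bounds for the denominators\<close>

lemma bcontent_ge:
  assumes "finite D" "b \<in> D" shows "real m + 1 / 2 \<le> bcontent D m b"
  using assms by (simp add: bcontent_def)

lemma bcontent_pos: "finite D \<Longrightarrow> b \<in> D \<Longrightarrow> 0 < bcontent D m b"
  using bcontent_ge[of D b m] by linarith

lemma bcontent_diff: "bcontent D m b - bcontent D m b' = real_of_int (content b - content b')"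
  by (simp add: bcontent_def)

lemma bcv_half_integer:
  assumes T: "T \<in> signed_fillings D n" and k: "k \<in> signed_set n"
  shows "\<exists>z::int. bcv D m T k = real_of_int z + 1 / 2"
proof -
  have *: "bcontent D m b = real_of_int (content b - Min (content ` D) + int m) + 1 / 2" for b
    by (simp add: bcontent_def)
  \<comment> \<open>Negation sends z + 1/2 to (-z - 1) + 1/2, so entries and their negatives are
    treated alike.\<close>
  then have **: "- bcontent D m b = real_of_int (- (content b - Min (content ` D) + int m) - 1) + 1 / 2" for b
    by simp
  show ?thesis using T k by (rule entry_cases) (use bcv_entry[OF T] * ** in metis)+
qed

lemma one_le_abs_diff:
  assumes "\<exists>z::int. a = real_of_int z + 1 / 2" "\<exists>z::int. b = real_of_int z + 1 / 2" "a \<noteq> b"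
  shows "1 \<le> \<bar>a - b\<bar>"
proof -
  obtain y z :: int where "a = real_of_int y + 1 / 2" "b = real_of_int z + 1 / 2" using assms by blast
  moreover have "1 \<le> \<bar>y - z\<bar>" using assms calculation by auto
  then have "1 \<le> real_of_int \<bar>y - z\<bar>" by linarith
  ultimately show ?thesis by simp
qed

text \<open>Equal contents have equal signs, so either both letters or both their negatives are
  entries of \<open>D\<close>, on one diagonal, and two entries lie strictly between. No two entries
  are opposite, which gives the clause on absolute values; it is what settles the pair -2, 1
  below.\<close>

lemma bcv_eq_imp_between:
  assumes D: "skew_shape D" and T: "T \<in> Btab D m n"
    and k: "k \<in> signed_set n" and l: "l \<in> signed_set n" and kl: "k < l" and eq: "bcv D m T k = bcv D m T l"
  shows "\<exists>x\<in>{k<..<l}. \<exists>y\<in>{k<..<l}. x \<noteq> y \<and> x \<noteq> 0 \<and> y \<noteq> 0 \<and> \<bar>x\<bar> \<notin> {\<bar>k\<bar>, \<bar>l\<bar>} \<and> \<bar>y\<bar> \<notin> {\<bar>k\<bar>, \<bar>l\<bar>}"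
proof -
  have sf: "T \<in> signed_fillings D n" and st: "standard D T" using T by (auto simp: Btab_eq)
  have fin: "finite D" using D by (rule skew_shape_finite)
  have inj: "T x = T y \<longleftrightarrow> x = y" if "x \<in> D" "y \<in> D" for x y
    using sf that by (auto simp: signed_fillings_def inj_on_def)
  have key: "\<exists>x\<in>{T b<..<T b'}. \<exists>y\<in>{T b<..<T b'}. x \<noteq> y \<and> x \<noteq> 0 \<and> y \<noteq> 0 \<and>
      \<bar>x\<bar> \<notin> {\<bar>T b\<bar>, \<bar>T b'\<bar>} \<and> \<bar>y\<bar> \<notin> {\<bar>T b\<bar>, \<bar>T b'\<bar>}"
    if b: "b \<in> D" "b' \<in> D" "T b < T b'" "bcontent D m b = bcontent D m b'" for b b'
  proof -
    have "content b = content b'" using b(4) bcontent_diff[of D m b b'] by simp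
    then obtain x y where xy: "x \<in> D" "y \<in> D" "x \<noteq> y" "T b < T x" "T x < T b'" "T b < T y" "T y < T b'"
      using standard_same_content[OF D st b(1,2)] b(3) by blast
    have nz: "T z \<noteq> 0" if "z \<in> D" for z using entry_signed_set[OF sf that] by (auto simp: signed_set_def)
    have opp: "T z \<noteq> - T w" if "z \<in> D" "w \<in> D" for z w using minus_entry[OF sf that(2)] that(1) by force
    have a: "\<bar>T z\<bar> \<noteq> \<bar>T w\<bar>" if "z \<in> D" "w \<in> D" "T z \<noteq> T w" for z w
      using opp[OF that(1,2)] that(3) by (auto simp: abs_eq_iff)
    show ?thesis using xy nz a[OF _ b(1)] a[OF _ b(2)] inj
      by (intro bexI[of _ "T x"] bexI[of _ "T y"]) auto
  qed
  from sf k show ?thesis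
  proof (rule entry_cases)
    fix b assume b: "b \<in> D" "k = T b"
    from sf l show ?thesis
    proof (rule entry_cases)
      fix b' assume b': "b' \<in> D" "l = T b'"
      then show ?thesis using key[OF b(1) b'(1)] b kl eq bcv_entry[OF sf] by auto
    next
      fix b' assume b': "b' \<in> D" "l = - T b'"
      then show ?thesis
        using b eq bcv_entry[OF sf] bcontent_pos[OF fin b(1), of m] bcontent_pos[OF fin b'(1), of m] by simp
    qed
  next
    fix b assume b: "b \<in> D" "k = - T b"
    from sf l show ?thesis
    proof (rule entry_cases)
      fix b' assume b': "b' \<in> D" "l = T b'"
      then show ?thesis
        using b eq bcv_entry[OF sf] bcontent_pos[OF fin b(1), of m] bcontent_pos[OF fin b'(1), of m] by simp
    next
      fix b' assume b': "b' \<in> D" "l = - T b'"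
      then obtain x y where "x \<in> {T b'<..<T b}" "y \<in> {T b'<..<T b}" "x \<noteq> y" "x \<noteq> 0" "y \<noteq> 0"
        "\<bar>x\<bar> \<notin> {\<bar>T b'\<bar>, \<bar>T b\<bar>}" "\<bar>y\<bar> \<notin> {\<bar>T b'\<bar>, \<bar>T b\<bar>}"
        using key[OF b'(1) b(1)] b kl eq bcv_entry[OF sf] by auto
      then show ?thesis using b b' by (intro bexI[of _ "- x"] bexI[of _ "- y"]) auto
    qed
  qed
qed

text \<open>Each interval is too short for two intermediate letters: between i and i + 1 there is
  none, between i and i + 2 one, and between -2 and 1 only 0 and -1, the latter excluded by its
  absolute value.\<close>

lemma bcv_neq:
  assumes D: "skew_shape D" and T: "T \<in> Btab D m n"
  shows "0 < i \<Longrightarrow> i < n \<Longrightarrow> bcv D m T (int i) \<noteq> bcv D m T (int i + 1)"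
    and "0 < i \<Longrightarrow> Suc i < n \<Longrightarrow> bcv D m T (int i) \<noteq> bcv D m T (int i + 2)"
    and "1 < n \<Longrightarrow> bcv D m T 1 + bcv D m T 2 \<noteq> 0"
proof -
  have sf: "T \<in> signed_fillings D n" using T by (auto simp: Btab_eq)
  show "0 < i \<Longrightarrow> i < n \<Longrightarrow> bcv D m T (int i) \<noteq> bcv D m T (int i + 1)"
    using bcv_eq_imp_between[OF D T, of "int i" "int i + 1"] by (auto simp: signed_set_def)
  show "0 < i \<Longrightarrow> Suc i < n \<Longrightarrow> bcv D m T (int i) \<noteq> bcv D m T (int i + 2)"
    using bcv_eq_imp_between[OF D T, of "int i" "int i + 2"] by (auto simp: signed_set_def)
  assume n: "1 < n"
  then have "bcv D m T (- 2) = - bcv D m T 2" by (intro bcv_minus[OF sf]) (simp add: signed_set_def)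
  moreover have "bcv D m T (- 2) \<noteq> bcv D m T 1"
    using bcv_eq_imp_between[OF D T, of "-2" 1] n by (auto simp: signed_set_def)
  ultimately show "bcv D m T 1 + bcv D m T 2 \<noteq> 0" by linarith
qed

lemma abs_bcv_ge:
  assumes "finite D" "T \<in> signed_fillings D n" "k \<in> signed_set n"
  shows "real m + 1 / 2 \<le> \<bar>bcv D m T k\<bar>"
  using assms(2,3) by (rule entry_cases) (use bcv_entry[OF assms(2)] bcontent_ge[OF assms(1), of _ m] in fastforce)+

lemma gen_less:
  assumes "x < y" "x \<noteq> 0" "y \<noteq> 0" "x = - 1 \<Longrightarrow> y \<noteq> 1" "x = int i \<Longrightarrow> y \<noteq> int i + 1" "x = - int i - 1 \<Longrightarrow> y \<noteq> - int i"
  shows "gen i x < gen i y"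
  using assms by (auto simp: gen_apply)

text \<open>A swap can break standardness only at two entries in one row or column that it
  exchanges. These are consecutive integers, so no box fits between theirs and the contents differ
  by one. This is exactly when the off-diagonal coefficient vanishes.\<close>

lemma act_gen_not_standard:
  assumes D: "skew_shape D" and T: "T \<in> Btab D m n" and i: "i < n" and non: "act (gen i) T \<notin> Btab D m' n"
  shows "0 < i \<and> \<bar>fvec D m T i\<bar> = 1"
proof -
  have sf: "T \<in> signed_fillings D n" and st: "standard D T" using T by (auto simp: Btab_eq)
  have "\<not> standard D (act (gen i) T)"
    using non act_signed_fillings[OF gen_Bgroup[OF i] sf] by (simp add: Btab_eq)
  then obtain b b' where b: "b \<in> D" "b' \<in> D" "T b < T b'" "\<not> gen i (T b) < gen i (T b')"
    and rc: "fst b = fst b' \<and> snd b < snd b' \<or> snd b = snd b' \<and> fst b < fst b'"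
    unfolding standard_def act_def using standard_row[OF st] standard_col[OF st] by fastforce
  have nz: "T b \<noteq> 0" "T b' \<noteq> 0" using entry_signed_set[OF sf] b by (auto simp: signed_set_def)
  have "\<not> (T b = -1 \<and> T b' = 1)" using minus_entry[OF sf b(1)] b(2) by force
  then have cases: "T b = int i \<and> T b' = int i + 1 \<or> T b = - int i - 1 \<and> T b' = - int i"
    using gen_less[of "T b" "T b'" i] b nz by blast
  then have next_to: "T b' = T b + 1" by auto
  obtain r c r' c' where bb: "b = (r, c)" "b' = (r', c')" by (cases b, cases b')
  have D': "(r, c) \<in> D" "(r', c') \<in> D" and nx: "T (r', c') = T (r, c) + 1"
    using b(1,2) next_to by (simp_all add: bb)
  have "\<bar>content b' - content b\<bar> = 1"
    using rc[unfolded bb fst_conv snd_conv]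
  proof (elim disjE conjE)
    assume r: "r = r'" "c < c'"
    have "\<not> c + 1 < c'"
    proof
      assume lt: "c + 1 < c'"
      have "(r, c + 1) \<in> D" using skew_shape_convex[OF D D'] r lt by simp
      then show False
        using standard_row[OF st D'(1), of "c + 1"] standard_row[OF st _ D'(2)[folded r(1)], of "c + 1"]
          r lt nx by fastforce
    qed
    then show ?thesis using r by (simp add: content_def bb)
  next
    assume r: "c = c'" "r < r'"
    have "\<not> r + 1 < r'"
    proof
      assume lt: "r + 1 < r'"
      have "(r + 1, c) \<in> D" using skew_shape_convex[OF D D'] r lt by simp
      then show False
        using standard_col[OF st D'(1), of "r + 1"] standard_col[OF st _ D'(2)[folded r(1)], of "r + 1"]
          r lt nx by fastforce
    qed
    then show ?thesis using r by (simp add: content_def bb)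
  qed
  then have one: "\<bar>bcontent D m b' - bcontent D m b\<bar> = 1" by (simp add: bcontent_diff)
  \<comment> \<open>For \<open>i = 0\<close> either alternative would place the entry 0 in a
    box.\<close>
  have "0 < i" using cases nz by (auto intro: gr0I)
  moreover have "\<bar>fvec D m T i\<bar> = 1"
    using cases
  proof (elim disjE conjE)
    assume *: "T b = int i" "T b' = int i + 1"
    then show ?thesis using one \<open>0 < i\<close> bcv_entry[OF sf b(1), of m] bcv_entry[OF sf b(2), of m] by (simp add: fvec_def)
  next
    assume *: "T b = - int i - 1" "T b' = - int i"
    then have "int i + 1 = - T b" "int i = - T b'" by auto
    then show ?thesis using one \<open>0 < i\<close> bcv_entry[OF sf b(1), of m] bcv_entry[OF sf b(2), of m] by (simp add: fvec_def)
  qed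
  ultimately show ?thesis by simp
qed

lemma abs_fvec_ge_1:
  assumes D: "skew_shape D" and T: "T \<in> Btab D m n" and i: "i < n" and m: "1 \<le> m"
  shows "1 \<le> \<bar>fvec D m T i\<bar>"
proof -
  have sf: "T \<in> signed_fillings D n" using T by (auto simp: Btab_eq)
  show ?thesis
  proof (cases "i = 0")
    case True
    then show ?thesis using abs_bcv_ge[OF skew_shape_finite[OF D] sf, of 1 m] i m
      by (simp add: fvec_def signed_set_def)
  next
    case False
    then have "int i \<in> signed_set n" "int i + 1 \<in> signed_set n" using i by (auto simp: signed_set_def)
    then show ?thesis using one_le_abs_diff bcv_half_integer[OF sf] bcv_neq(1)[OF D T, of i] False i
      by (simp add: fvec_def)
  qed
qed

lemma finite_Btab: "finite D \<Longrightarrow> finite (Btab D m n)"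
  by (rule finite_subset[OF _ finite_set_of_finite_funs[OF _ finite_signed_set[of n], of D 0]])
     (auto simp: Btab_def)

definition word_op :: "box set \<Rightarrow> nat \<Rightarrow> nat list \<Rightarrow> (filling \<Rightarrow> real) \<Rightarrow> filling \<Rightarrow> real" where
  "word_op D m ws v = foldr (\<lambda>i. seminormal (\<lambda>T. fvec D m T i) (act (gen i))) ws v"

text \<open>A step leaving the standard tableaux has coefficient \<open>0\<close>, so the operators may be
  computed on all fillings.\<close>

lemma rho_gen_sum:
  assumes D: "skew_shape D" and T: "T \<in> Btab D m n" and i: "i < n"
    and w: "act (gen i) T \<in> Btab D m n \<Longrightarrow> w (act (gen i) T) = v (act (gen i) T)" "w T = v T"
  shows "(\<Sum>U\<in>Btab D m n. rho_gen D m i T U * w U)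
       = seminormal (\<lambda>T. fvec D m T i) (act (gen i)) v T"
proof -
  let ?X = "Btab D m n" and ?f = "\<lambda>U. fvec D m U i" and ?s = "act (gen i)"
  have fin: "finite ?X" using D by (simp add: finite_Btab skew_shape_finite)
  have sf: "T \<in> signed_fillings D n" using T by (auto simp: Btab_eq)
  have swap: "T = ?s U \<longleftrightarrow> ?s T = U" for U by auto
  have "rho_gen D m i T U * w U = (if T = U then 1 / ?f U * w U else 0)
      + (if ?s T = U then sqrt (1 - 1 / (?f U)\<^sup>2) * w U else 0)" for U
    unfolding rho_gen_def Let_def swap by (simp add: algebra_simps)
  then have "(\<Sum>U\<in>?X. rho_gen D m i T U * w U) = (\<Sum>U\<in>?X. if T = U then 1 / ?f U * w U else 0)
      + (\<Sum>U\<in>?X. if ?s T = U then sqrt (1 - 1 / (?f U)\<^sup>2) * w U else 0)"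
    by (simp add: sum.distrib)
  also have "\<dots> = 1 / ?f T * w T + (if ?s T \<in> ?X then sqrt (1 - 1 / (?f (?s T))\<^sup>2) * w (?s T) else 0)"
    using fin T by simp
  also have "\<dots> = 1 / ?f T * v T + sqrt (1 - 1 / (?f T)\<^sup>2) * v (?s T)"
  proof (cases "?s T \<in> ?X")
    case True
    then show ?thesis using w fvec_act_gen(1)[OF sf i, of m] by simp
  next
    case False
    then have "\<bar>?f T\<bar> = 1" using act_gen_not_standard[OF D T i] by blast
    then have "(?f T)\<^sup>2 = 1" by (metis one_power2 power2_abs)
    then show ?thesis using False w(2) by simp
  qed
  finally show ?thesis by (simp add: seminormal_def)
qed

lemma word_op_eq:
  assumes D: "skew_shape D" and "set ws \<subseteq> {..<n}" and "T \<in> Btab D m n"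
  shows "(\<Sum>U\<in>Btab D m n. word_mat (Btab D m n) (rho_gen D m) ws T U * v U) = word_op D m ws v T"
  using assms(2,3)
proof (induction ws arbitrary: T)
  case Nil
  then show ?case using D by (simp add: word_op_def word_mat_Nil sum_mat_id finite_Btab skew_shape_finite)
next
  case (Cons i ws)
  let ?X = "Btab D m n" and ?M = "rho_gen D m"
  have "(\<Sum>U\<in>?X. word_mat ?X ?M (i # ws) T U * v U)
      = (\<Sum>W\<in>?X. ?M i T W * (\<Sum>U\<in>?X. word_mat ?X ?M ws W U * v U))"
    by (simp add: word_mat_Cons sum_mat_assoc)
  also have "\<dots> = word_op D m (i # ws) v T"
    unfolding word_op_def foldr_Cons comp_def
    using Cons by (intro rho_gen_sum[OF D]) (auto simp: word_op_def)
  finally show ?case .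
qed

section \<open>Coxeter relations between the generator matrices\<close>

lemma word_mat_eqI:
  assumes D: "skew_shape D" and ws: "set ws \<subseteq> {..<n}" "set us \<subseteq> {..<n}"
    and T: "T \<in> Btab D m n" "U \<in> Btab D m n" and eq: "\<And>v. word_op D m ws v T = word_op D m us v T"
  shows "word_mat (Btab D m n) (rho_gen D m) ws T U = word_mat (Btab D m n) (rho_gen D m) us T U"
proof -
  let ?W = "word_mat (Btab D m n) (rho_gen D m)"
  have "finite (Btab D m n)" using D by (simp add: finite_Btab skew_shape_finite)
  then have "?W xs T U = word_op D m xs (\<lambda>V. mat_id V U) T" if "set xs \<subseteq> {..<n}" for xs
    using word_op_eq[OF D that T(1), of "\<lambda>V. mat_id V U"] sum_mat_id(2)[OF _ T(2)] by simp
  then show ?thesis using ws eq by simp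
qed

text \<open>Equality of permutations is built in because the normal form argument reads the coset of
  a word off its permutation, which the matrices alone do not obviously determine.\<close>

definition rho_congruent :: "box set \<Rightarrow> nat \<Rightarrow> nat \<Rightarrow> nat list \<Rightarrow> nat list \<Rightarrow> bool" where
  "rho_congruent D m n us ws \<longleftrightarrow> word_perm us = word_perm ws \<and>
    (\<forall>T\<in>Btab D m n. \<forall>U\<in>Btab D m n.
       word_mat (Btab D m n) (rho_gen D m) us T U = word_mat (Btab D m n) (rho_gen D m) ws T U)"

lemma act_gen_commute: "i + 1 < j \<Longrightarrow> act (gen i) (act (gen j) T) = act (gen j) (act (gen i) T)"
  by (metis act_act gen_commute)

lemma act_gen_braid:
  "0 < i \<Longrightarrow> act (gen i) (act (gen (Suc i)) (act (gen i) T)) = act (gen (Suc i)) (act (gen i) (act (gen (Suc i)) T))"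
  by (simp add: act_act comp_assoc gen_braid)

lemma act_gen_braid_0:
  "act (gen 1) (act (gen 0) (act (gen 1) (act (gen 0) T))) = act (gen 0) (act (gen 1) (act (gen 0) (act (gen 1) T)))"
  by (simp add: act_act comp_assoc gen_braid_0)

text \<open>The bounds on denominators hold at standard tableaux, while the transformation rules of
  \<open>fvec\<close> hold on \<open>?Y\<close>, which is closed under relabelling. Hence the braid
  lemmas separate the point \<open>x\<close> from the set \<open>Y\<close>.\<close>

lemma rho_coxeter_congruence:
  assumes D: "skew_shape D" and m: "1 \<le> m"
  shows "coxeter_congruence n (rho_congruent D m n)"
proof
  let ?X = "Btab D m n" and ?Y = "signed_fillings D n"
  note E = rho_congruent_def
  have fin: "finite ?X" using D by (simp add: finite_Btab skew_shape_finite)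
  have sub: "T \<in> ?Y" if "T \<in> ?X" for T using that by (auto simp: Btab_eq)
  have ge: "1 \<le> \<bar>fvec D m T i\<bar>" if "T \<in> ?X" "i < n" for T i using abs_fvec_ge_1[OF D that m] .
  have clo: "act (gen i) T \<in> ?Y" if "i < n" "T \<in> ?Y" for i T
    using act_signed_fillings[OF gen_Bgroup[OF that(1)] that(2)] .
  fix us vs ws xs ys :: "nat list" and i j :: nat
  show "rho_congruent D m n ws ws" by (simp add: E)
  show "rho_congruent D m n us ws \<Longrightarrow> rho_congruent D m n ws us" by (simp add: E)
  show "rho_congruent D m n us vs \<Longrightarrow> rho_congruent D m n vs ws \<Longrightarrow> rho_congruent D m n us ws" by (simp add: E)
  show "rho_congruent D m n us ws \<Longrightarrow> rho_congruent D m n (xs @ us @ ys) (xs @ ws @ ys)"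
    by (simp add: E word_mat_append[OF fin])
  show "rho_congruent D m n us ws \<Longrightarrow> word_perm us = word_perm ws" by (simp add: E)
  show "rho_congruent D m n [i, i] []" if i: "i < n"
    unfolding E
  proof (intro conjI ballI word_mat_eqI[OF D])
    fix T v assume T: "T \<in> ?X"
    then show "word_op D m [i, i] v T = word_op D m [] v T"
      using fvec_act_gen(1)[OF sub[OF T] i] ge[OF T i] by (simp add: word_op_def seminormal_square)
  qed (use i in auto)
  show "rho_congruent D m n [i, j] [j, i]" if ij: "i + 1 < j" "j < n"
    unfolding E
  proof (intro conjI ballI word_mat_eqI[OF D])
    fix T v assume T: "T \<in> ?X"
    show "word_op D m [i, j] v T = word_op D m [j, i] v T"
      unfolding word_op_def foldr.simps comp_def id_def
      using ij fvec_act_gen(2)[OF sub[OF T], of i j] fvec_act_gen(2)[OF sub[OF T], of j i]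
      by (intro seminormal_commute act_gen_commute) auto
  qed (use ij gen_commute in auto)
  show "rho_congruent D m n [i, Suc i, i] [Suc i, i, Suc i]" if i: "0 < i" "Suc i < n"
    unfolding E
  proof (intro conjI ballI word_mat_eqI[OF D])
    fix T v assume T: "T \<in> ?X"
    have i': "i < n" using i by simp
    \<comment> \<open>The sum telescopes to the difference of the contents of i + 2 and i.\<close>
    have "fvec D m T i + fvec D m T (Suc i) \<noteq> 0"
      using bcv_neq(2)[OF D T i] i by (simp add: fvec_def algebra_simps)
    then show "word_op D m [i, Suc i, i] v T = word_op D m [Suc i, i, Suc i] v T"
      unfolding word_op_def foldr.simps comp_def id_def
      using i i' ge[OF T] sub[OF T] clo
      by (intro seminormal_braid[where Y = ?Y])
         (simp_all add: act_gen_braid fvec_act_gen(1) fvec_act_gen(3) fvec_act_gen(4))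
  qed (use i gen_braid in auto)
  show "rho_congruent D m n [0, 1, 0, 1] [1, 0, 1, 0]" if n: "1 < n"
    unfolding E
  proof (intro conjI ballI word_mat_eqI[OF D])
    fix T v assume T: "T \<in> ?X"
    have n0: "0 < n" using n by simp
    have mem: "1 \<in> signed_set n" "2 \<in> signed_set n" "-2 \<in> signed_set n" using n by (auto simp: signed_set_def)
    \<comment> \<open>Writing c_1 + c_2 as c_1 - c_(-2) makes it a difference of half-integers, at
      least 1 in absolute value once they are distinct.\<close>
    have f: "fvec D m T 0 + fvec D m T 1 = bcv D m T 1 - bcv D m T (- 2)"
      "fvec D m T 0 + 2 * fvec D m T 1 = 2 * bcv D m T 2"
      using bcv_minus[OF sub[OF T] mem(2)] by (simp_all add: fvec_def)
    have "bcv D m T 1 \<noteq> bcv D m T (- 2)"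
      using bcv_neq(3)[OF D T n] bcv_minus[OF sub[OF T] mem(2)] by simp
    then have "1 \<le> \<bar>fvec D m T 0 + fvec D m T 1\<bar>"
      unfolding f using one_le_abs_diff bcv_half_integer[OF sub[OF T]] mem by simp
    moreover have "1 \<le> \<bar>fvec D m T 0 + 2 * fvec D m T 1\<bar>"
      unfolding f using abs_bcv_ge[OF skew_shape_finite[OF D] sub[OF T] mem(2), of m] m by simp
    ultimately show "word_op D m [0, 1, 0, 1] v T = word_op D m [1, 0, 1, 0] v T"
      unfolding word_op_def foldr.simps comp_def id_def
      using n n0 ge[OF T] sub[OF T] clo
      by (intro seminormal_braid4[where Y = ?Y])
         (simp_all add: act_gen_braid_0[unfolded One_nat_def] fvec_act_gen(1) fvec_act_gen(5)[unfolded One_nat_def]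
           fvec_act_gen(6)[unfolded One_nat_def])
  qed (use n gen_braid_0 in auto)
qed

section \<open>Restriction to the symmetric group and dimension count\<close>

text \<open>The description in \<open>ext_rep\<close> is satisfied because all words for the element
  give one matrix, and its solution is unique because \<open>ws\<close> is such a word.\<close>

lemma ext_rep_word:
  assumes "set ws \<subseteq> I"
    and "\<And>us a c. set us \<subseteq> I \<Longrightarrow> word_perm us = word_perm ws \<Longrightarrow> a \<in> X \<Longrightarrow> c \<in> X \<Longrightarrow>
      word_mat X M us a c = word_mat X M ws a c"
  shows "ext_rep X M I (word_perm ws) = (\<lambda>a c. if a \<in> X \<and> c \<in> X then word_mat X M ws a c else 0)"
  unfolding ext_rep_def
proof (rule the_equality)
  show "\<forall>us. set us \<subseteq> I \<and> word_perm us = word_perm ws \<longrightarrow>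
      (\<lambda>a c. if a \<in> X \<and> c \<in> X then word_mat X M ws a c else 0) =
      (\<lambda>a c. if a \<in> X \<and> c \<in> X then word_mat X M us a c else 0)"
    using assms(2) by (auto simp: fun_eq_iff)
qed (use assms(1) in blast)

lemma syt_eq: "syt D n = {T \<in> Btab D m n. \<forall>b\<in>D. 0 < T b}"
proof (intro equalityI subsetI)
  fix T assume "T \<in> syt D n"
  then have T: "bij_betw T D {1..int n}" "\<forall>b. b \<notin> D \<longrightarrow> T b = 0" "standard D T" by (auto simp: syt_def)
  then have im: "T ` D = {1..int n}" and inj: "inj_on T D" by (simp_all add: bij_betw_def)
  have "T \<in> signed_fillings D n"
    unfolding signed_fillings_def mem_Collect_eq im using inj T(2) by (auto simp: signed_set_def)
  moreover have "0 < T b" if "b \<in> D" for b using im imageI[OF that, of T] by simp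
  ultimately show "T \<in> {T \<in> Btab D m n. \<forall>b\<in>D. 0 < T b}"
    using T(3) by (simp add: Btab_eq)
next
  fix T assume "T \<in> {T \<in> Btab D m n. \<forall>b\<in>D. 0 < T b}"
  then have sf: "T \<in> signed_fillings D n" and st: "standard D T" and pos: "\<And>b. b \<in> D \<Longrightarrow> 0 < T b"
    by (auto simp: Btab_eq)
  have "T ` D = {1..int n}"
  proof (intro equalityI subsetI)
    fix k assume "k \<in> T ` D"
    then show "k \<in> {1..int n}" using entry_signed_set[OF sf] pos by (force simp: signed_set_def)
  next
    fix k assume k: "k \<in> {1..int n}"
    then have "k \<in> signed_set n" by (auto simp: signed_set_def)
    with sf show "k \<in> T ` D" by (rule entry_cases) (use pos k in force)+
  qed
  then show "T \<in> syt D n" using sf st by (auto simp: syt_def signed_fillings_def bij_betw_def)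
qed

lemma syt_Btab: "T \<in> syt D n \<Longrightarrow> T \<in> Btab D m n"
  by (simp add: syt_eq[of D n m])

lemma syt_image: "T \<in> syt D n \<Longrightarrow> T ` D = {1..int n}"
  by (simp add: syt_def bij_betw_def)

lemma act_gen_syt:
  assumes "0 < i" "V \<in> syt D n" "act (gen i) V \<in> Btab D m n" shows "act (gen i) V \<in> syt D n"
proof -
  have "0 < V b" if "b \<in> D" for b using that assms(2) by (auto simp: syt_eq[of D n m])
  then show ?thesis using assms(1,3) by (fastforce simp: syt_eq[of D n m] act_def gen_pos)
qed

text \<open>Both letters lie in boxes of \<open>D\<close>, so the offset in \<open>bcontent\<close>
  cancels from the difference.\<close>

lemma rho_gen_eq_young_gen:
  assumes V: "V \<in> syt D n" and i: "0 < i" "i < n"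
  shows "rho_gen D m i T V = young_gen D i T V"
proof -
  have sf: "V \<in> signed_fillings D n" using syt_Btab[OF V] by (auto simp: Btab_eq)
  have "int i \<in> V ` D" "int i + 1 \<in> V ` D" using syt_image[OF V] i by auto
  then obtain b b' where b: "b \<in> D" "V b = int i" "b' \<in> D" "V b' = int i + 1" by (metis imageE)
  have "box_of D V (int i) = b" "box_of D V (int i + 1) = b'"
    using box_of_eq[OF sf b(1)] box_of_eq[OF sf b(3)] b by simp_all
  moreover have "fvec D m V i = real_of_int (content b' - content b)"
    using bcv_entry(1)[OF sf b(1)] bcv_entry(1)[OF sf b(3)] b i by (simp add: fvec_def bcontent_diff)
  ultimately show ?thesis by (simp add: rho_gen_def young_gen_def)
qed

text \<open>Generators other than s_0 keep positive entries positive, so the columns of positive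
  tableaux are supported on positive tableaux. Well-definedness of the Young matrices is read off
  from this block.\<close>

lemma word_mat_syt:
  assumes D: "skew_shape D" and Q: "Q \<in> syt D n" and "set ws \<subseteq> {1..<n}" "T \<in> Btab D m n"
  shows "word_mat (Btab D m n) (rho_gen D m) ws T Q
       = (if T \<in> syt D n then word_mat (syt D n) (young_gen D) ws T Q else 0)"
  using assms(3,4)
proof (induction ws arbitrary: T)
  case Nil
  then show ?case using Q by (auto simp: word_mat_Nil mat_id_def)
next
  case (Cons i ws)
  let ?X = "Btab D m n" and ?Z = "syt D n"
  have i: "0 < i" "i < n" using Cons.prems by auto
  have fin: "finite ?X" using D by (simp add: finite_Btab skew_shape_finite)
  have sub: "?Z \<subseteq> ?X" using syt_Btab by blast
  have "word_mat ?X (rho_gen D m) (i # ws) T Q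
      = (\<Sum>V\<in>?X. rho_gen D m i T V * (if V \<in> ?Z then word_mat ?Z (young_gen D) ws V Q else 0))"
    unfolding word_mat_Cons using Cons by (intro sum.cong) auto
  also have "\<dots> = (\<Sum>V\<in>?Z. young_gen D i T V * word_mat ?Z (young_gen D) ws V Q)"
    using fin sub i by (intro sum.mono_neutral_cong_right) (auto simp: rho_gen_eq_young_gen)
  also have "\<dots> = (if T \<in> ?Z then word_mat ?Z (young_gen D) (i # ws) T Q else 0)"
  proof (cases "T \<in> ?Z")
    case False
    then have "young_gen D i T V = 0" if "V \<in> ?Z" for V
      using act_gen_syt[OF i(1) that, of m] that Cons.prems(2) by (auto simp: young_gen_def Let_def)
    then show ?thesis using False by simp
  qed (simp add: word_mat_Cons)
  finally show ?case .
qed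

section \<open>Counting the two bases\<close>

lemma strict_mono_signed_permutation:
  assumes fin: "finite E" and card: "card E = n" and E: "E \<subseteq> signed_set n" "\<And>k. k \<in> E \<Longrightarrow> - k \<notin> E"
  shows "\<exists>g\<in>Bgroup n. g ` {1..int n} = E \<and> strict_mono_on {1..int n} g"
proof -
  obtain h where h: "bij_betw h {0..<n} E" "strict_mono_on {0..<n} h"
  proof
    show "bij_betw ((!) (sorted_list_of_set E)) {0..<n} E"
      using fin card by (intro bij_betw_nth) (auto simp: atLeast0LessThan)
    show "strict_mono_on {0..<n} ((!) (sorted_list_of_set E))"
      using card by (intro strict_mono_onI sorted_wrt_nth_less[OF strict_sorted_list_of_set]) auto
  qed
  \<comment> \<open>The sorted list is indexed from 0, the letters from 1.\<close>
  define e where "e k = h (nat (k - 1))" for k :: int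
  have e_mem: "e k \<in> E" if "1 \<le> k" "k \<le> int n" for k
    using that bij_betwE[OF h(1)] by (auto simp: e_def)
  have e_less: "e k < e l" if "1 \<le> k" "k < l" "l \<le> int n" for k l
    unfolding e_def using that by (intro strict_mono_onD[OF h(2)]) auto
  \<comment> \<open>The odd extension; it stays injective because \<open>E\<close> contains no two
    opposite letters.\<close>
  define g where "g k = (if 1 \<le> k \<and> k \<le> int n then e k else if 1 \<le> - k \<and> - k \<le> int n then - e (- k) else k)" for k
  have g_pos: "g k = e k" if "1 \<le> k" "k \<le> int n" for k using that by (simp add: g_def)
  have g_minus: "g (- k) = - g k" for k by (auto simp: g_def)
  have g_mem: "g k \<in> signed_set n" if "k \<in> signed_set n" for k
  proof (cases "0 < k")
    case True
    then show ?thesis using e_mem[of k] E(1) that by (auto simp: g_def signed_set_def)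
  next
    case False
    then have "e (- k) \<in> signed_set n" "g k = - e (- k)"
      using e_mem[of "- k"] E(1) that by (auto simp: g_def signed_set_def)
    then show ?thesis by (simp add: signed_set_minus)
  qed
  have e_inj: "k = l" if "e k = e l" "1 \<le> k" "k \<le> int n" "1 \<le> l" "l \<le> int n" for k l
    using e_less[of k l] e_less[of l k] that by (cases k l rule: linorder_cases) auto
  have e_opp: "e k \<noteq> - e l" if "1 \<le> k" "k \<le> int n" "1 \<le> l" "l \<le> int n" for k l
    using e_mem[of k] e_mem[of l] E(2)[of "e l"] that by auto
  have g_inj: "inj_on g (signed_set n)"
  proof (rule inj_onI)
    fix k l assume kl: "k \<in> signed_set n" "l \<in> signed_set n" "g k = g l"
    consider "0 < k" "0 < l" | "0 < k" "l < 0" | "k < 0" "0 < l" | "k < 0" "l < 0"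
      using kl by (fastforce simp: signed_set_def)
    then show "k = l"
    proof cases
      case 1
      then show ?thesis using kl e_inj[of k l] by (auto simp: g_def signed_set_def)
    next
      case 2
      then show ?thesis using kl e_opp[of k "- l"] by (auto simp: g_def signed_set_def)
    next
      case 3
      then show ?thesis using kl e_opp[of l "- k"] by (auto simp: g_def signed_set_def)
    next
      case 4
      then show ?thesis using kl e_inj[of "- k" "- l"] by (auto simp: g_def signed_set_def)
    qed
  qed
  have "bij_betw g (signed_set n) (signed_set n)"
    using g_inj endo_inj_surj[OF finite_signed_set _ g_inj] g_mem unfolding bij_betw_def by blast
  then have "g permutes signed_set n"
    by (rule bij_imp_permutes) (auto simp: g_def signed_set_def)
  then have B: "g \<in> Bgroup n" using g_minus by (simp add: Bgroup_def)
  have "g ` {1..int n} = E"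
  proof (intro equalityI subsetI)
    fix k assume "k \<in> g ` {1..int n}"
    then show "k \<in> E" using g_pos e_mem by auto
  next
    fix k assume "k \<in> E"
    then obtain j where "j < n" "k = h j" using bij_betw_imp_surj_on[OF h(1)] by auto
    then have "k = g (int j + 1)" "int j + 1 \<in> {1..int n}" by (auto simp: g_def e_def)
    then show "k \<in> g ` {1..int n}" by blast
  qed
  moreover have "strict_mono_on {1..int n} g"
    by (rule strict_mono_onI) (auto simp: g_pos e_less)
  ultimately show ?thesis using B by blast
qed

text \<open>A standard B-tableau amounts to its set of entries together with the relative order of
  these entries. The former is a coset of S_n, the latter a standard Young tableau.\<close>

lemma card_induced_basis:
  assumes D: "skew_shape D" and card: "card D = n"
  shows "card (induced_basis (Bgroup n) (Sgroup n) (syt D n)) = card (Btab D m n)"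
proof -
  let ?I = "{1..int n}" and ?R = "transversal (Bgroup n) (Sgroup n)"
  define good where "good E \<longleftrightarrow> finite E \<and> card E = n \<and> E \<subseteq> signed_set n \<and> (\<forall>k\<in>E. - k \<notin> E)" for E
  have "\<forall>E. \<exists>g. good E \<longrightarrow> g \<in> Bgroup n \<and> g ` ?I = E \<and> strict_mono_on ?I g"
  proof
    fix E
    show "\<exists>g. good E \<longrightarrow> g \<in> Bgroup n \<and> g ` ?I = E \<and> strict_mono_on ?I g"
    proof (cases "good E")
      case True
      then show ?thesis using strict_mono_signed_permutation[of E n] unfolding good_def by blast
    qed simp
  qed
  then obtain w where w: "\<And>E. good E \<Longrightarrow> w E \<in> Bgroup n" "\<And>E. good E \<Longrightarrow> w E ` ?I = E"
    "\<And>E. good E \<Longrightarrow> strict_mono_on ?I (w E)"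
    by metis
  have good_image: "good (g ` ?I)" if g: "g \<in> Bgroup n" for g
  proof -
    have inj: "inj g" using Bgroup_bij[OF g] by (rule bij_is_inj)
    have "card (g ` ?I) = n" using card_image[OF inj_on_subset[OF inj]] by simp
    moreover have "g ` ?I \<subseteq> signed_set n"
    proof -
      have "?I \<subseteq> signed_set n" by (auto simp: signed_set_def)
      then show ?thesis using permutes_image[OF Bgroup_permutes[OF g]] by blast
    qed
    moreover have "- k \<notin> g ` ?I" if k: "k \<in> g ` ?I" for k
    proof
      assume "- k \<in> g ` ?I"
      then obtain x y where xy: "x \<in> ?I" "y \<in> ?I" "g x = - g y" using k by (auto elim!: imageE)
      then have "g x = g (- y)" using Bgroup_minus[OF g] by simp
      then have "x = - y" by (rule injD[OF inj])
      then show False using xy by simp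
    qed
    ultimately show ?thesis by (simp add: good_def)
  qed
  have good_entries: "good (T ` D)" if T: "T \<in> Btab D m n" for T
  proof -
    have sf: "T \<in> signed_fillings D n" using T by (simp add: Btab_eq)
    then have "card (T ` D) = n" using card card_image[of T D] by (auto simp: signed_fillings_def)
    then show ?thesis using sf skew_shape_finite[OF D] minus_entry[OF sf] by (auto simp: good_def signed_fillings_def)
  qed
  \<comment> \<open>Relabelling by \<open>r\<close> itself could destroy standardness, so
    \<open>r\<close> is replaced by the increasing element of its coset.\<close>
  define \<Phi> where "\<Phi> = (\<lambda>(r, Q). act (w (r ` ?I)) Q)"
  have image_\<Phi>: "act (w (r ` ?I)) Q ` D = r ` ?I" if "r \<in> ?R" "Q \<in> syt D n" for r Q
  proof -
    have "act (w (r ` ?I)) Q ` D = w (r ` ?I) ` Q ` D" by (auto simp: act_def)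
    then show ?thesis using w(2)[OF good_image[OF transversal_Bgroup[OF that(1)]]] syt_image[OF that(2)] by simp
  qed
  have "bij_betw \<Phi> (?R \<times> syt D n) (Btab D m n)"
    unfolding bij_betw_def
  proof (intro conjI inj_onI equalityI subsetI)
    fix y z assume "y \<in> ?R \<times> syt D n" "z \<in> ?R \<times> syt D n" "\<Phi> y = \<Phi> z"
    moreover obtain r Q r' Q' where yz: "y = (r, Q)" "z = (r', Q')" by (cases y, cases z)
    ultimately have r: "r \<in> ?R" "r' \<in> ?R" and Q: "Q \<in> syt D n" "Q' \<in> syt D n"
      and eq: "act (w (r ` ?I)) Q = act (w (r' ` ?I)) Q'" by (auto simp: \<Phi>_def)
    have "r ` ?I = r' ` ?I" using image_\<Phi>[OF r(1) Q(1)] image_\<Phi>[OF r(2) Q(2)] eq by simp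
    then have rr: "r = r'" using transversal_image_eq[OF r] by blast
    have "inj (w (r ` ?I))" using w(1)[OF good_image[OF transversal_Bgroup[OF r(1)]]] Bgroup_bij bij_is_inj by blast
    then have "Q = Q'" using eq rr by (auto simp: act_def fun_eq_iff dest: injD)
    then show "y = z" using rr yz by simp
  next
    fix T assume "T \<in> \<Phi> ` (?R \<times> syt D n)"
    then obtain r Q where r: "r \<in> ?R" and Q: "Q \<in> syt D n" and T: "T = act (w (r ` ?I)) Q" by (auto simp: \<Phi>_def)
    let ?w = "w (r ` ?I)"
    have good: "good (r ` ?I)" using good_image[OF transversal_Bgroup[OF r]] .
    have Qs: "Q \<in> signed_fillings D n" "standard D Q" using syt_Btab[OF Q] by (auto simp: Btab_eq)
    have mem: "Q b \<in> ?I" if "b \<in> D" for b using syt_image[OF Q] that by blast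
    have "standard D T"
      using Qs(2) mem strict_mono_onD[OF w(3)[OF good]] unfolding standard_def T act_def by meson
    then show "T \<in> Btab D m n" using act_signed_fillings[OF w(1)[OF good] Qs(1)] by (simp add: Btab_eq T)
  next
    fix T assume T: "T \<in> Btab D m n"
    let ?w = "w (T ` D)"
    have good: "good (T ` D)" using good_entries[OF T] .
    have sf: "T \<in> signed_fillings D n" and st: "standard D T" using T by (auto simp: Btab_eq)
    \<comment> \<open>The standardization of \<open>T\<close>: each entry is replaced by its
      rank.\<close>
    define Q where "Q = act (inv ?w) T"
    have b: "bij ?w" using w(1)[OF good] by (rule Bgroup_bij)
    have wQ: "?w (Q b) = T b" for b by (simp add: Q_def act_def b bij_is_surj surj_f_inv_f)
    have mem: "Q b \<in> ?I" if "b \<in> D" for b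
    proof -
      have "T b \<in> ?w ` ?I" using w(2)[OF good] that by simp
      then show ?thesis using b by (metis bij_is_inj inj_image_mem_iff wQ)
    qed
    have less: "Q x < Q y" if "x \<in> D" "y \<in> D" "T x < T y" for x y
      using strict_mono_on_less[OF w(3)[OF good] mem[OF that(1)] mem[OF that(2)]] that(3) by (simp add: wQ)
    have "standard D Q" using st less unfolding standard_def by blast
    moreover have "Q \<in> signed_fillings D n"
      unfolding Q_def by (rule act_signed_fillings[OF Bgroup_inv[OF w(1)[OF good]] sf])
    moreover have "0 < Q b" if "b \<in> D" for b using mem[OF that] by simp
    ultimately have Q: "Q \<in> syt D n" by (simp add: syt_eq[of D n m] Btab_eq)
    obtain r where r: "r \<in> ?R" "r ` ?I = ?w ` ?I" using transversal_ex[OF w(1)[OF good]] .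
    have "\<Phi> (r, Q) = T" using r(2) w(2)[OF good] wQ by (auto simp: \<Phi>_def act_def)
    then show "T \<in> \<Phi> ` (?R \<times> syt D n)" using r(1) Q by (metis SigmaI imageI)
  qed
  then show ?thesis unfolding induced_basis_def by (rule bij_betw_same_card)
qed

section \<open>The isomorphism\<close>

text \<open>Enumerating both index sets yields square matrices, where a one-sided inverse is
  two-sided. This stands in for a direct proof that the intertwiner is injective.\<close>

lemma square_right_inverse_is_left_inverse:
  fixes P :: "'y \<Rightarrow> 'x \<Rightarrow> real" and Q :: "'x \<Rightarrow> 'y \<Rightarrow> real"
  assumes fin: "finite X" "finite Y" and card: "card X = card Y"
    and QP: "\<And>a c. a \<in> X \<Longrightarrow> c \<in> X \<Longrightarrow> mat_mult Y Q P a c = mat_id a c"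
    and y: "y \<in> Y" "z \<in> Y"
  shows "mat_mult X P Q y z = mat_id y z"
proof -
  define N where "N = card X"
  obtain f where f: "bij_betw f {0..<N} X" using ex_bij_betw_nat_finite[OF fin(1)] N_def by blast
  obtain g where g: "bij_betw g {0..<N} Y" using ex_bij_betw_nat_finite[OF fin(2)] N_def card by auto
  define A where "A = mat N N (\<lambda>(i, j). Q (f i) (g j))"
  define B where "B = mat N N (\<lambda>(i, j). P (g i) (f j))"
  have c: "A \<in> carrier_mat N N" "B \<in> carrier_mat N N" by (auto simp: A_def B_def)
  have "A * B = 1\<^sub>m N"
  proof (rule eq_matI)
    fix i j assume "i < dim_row (1\<^sub>m N :: real mat)" "j < dim_col (1\<^sub>m N :: real mat)"
    then have ij: "i < N" "j < N" by auto
    then have fX: "f i \<in> X" "f j \<in> X" and inj: "f i = f j \<longleftrightarrow> i = j"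
      using f by (auto simp: bij_betw_def inj_on_def)
    have "(A * B) $$ (i, j) = (\<Sum>k\<in>{0..<N}. Q (f i) (g k) * P (g k) (f j))"
      using ij by (simp add: A_def B_def scalar_prod_def)
    also have "\<dots> = mat_mult Y Q P (f i) (f j)"
      unfolding mat_mult_def by (rule sum.reindex_bij_betw[OF g])
    finally show "(A * B) $$ (i, j) = (1\<^sub>m N) $$ (i, j)"
      using QP[OF fX] inj ij by (simp add: mat_id_def)
  qed (use c in auto)
  then have BA: "B * A = 1\<^sub>m N" using mat_mult_left_right_inverse[OF c] by simp
  obtain i j where ij: "i < N" "j < N" "y = g i" "z = g j"
  proof -
    have "y \<in> g ` {0..<N}" "z \<in> g ` {0..<N}" using y bij_betw_imp_surj_on[OF g] by simp_all
    then show thesis using that by auto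
  qed
  have inj: "g i = g j \<longleftrightarrow> i = j" using g ij by (auto simp: bij_betw_def inj_on_def)
  have "mat_mult X P Q y z = (\<Sum>k\<in>{0..<N}. P (g i) (f k) * Q (f k) (g j))"
    unfolding mat_mult_def ij by (rule sum.reindex_bij_betw[OF f, symmetric])
  also have "\<dots> = (B * A) $$ (i, j)"
    using ij by (simp add: A_def B_def scalar_prod_def)
  finally show ?thesis using BA ij inj by (simp add: mat_id_def)
qed

lemma rep_isoI:
  fixes Q :: "'x \<Rightarrow> 'y \<Rightarrow> real"
  assumes fin: "finite X" "finite Y" and card: "card X = card Y"
    and span: "\<And>x. x \<in> X \<Longrightarrow> \<exists>c. \<forall>a\<in>X. (\<Sum>y\<in>Y. Q a y * c y) = mat_id a x"
    and inter: "\<And>g x y. g \<in> G \<Longrightarrow> x \<in> X \<Longrightarrow> y \<in> Y \<Longrightarrow>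
      (\<Sum>z\<in>X. A g x z * Q z y) = (\<Sum>z\<in>Y. Q x z * B g z y)"
  shows "rep_iso X Y G A B"
proof -
  obtain c where c: "\<And>x a. x \<in> X \<Longrightarrow> a \<in> X \<Longrightarrow> (\<Sum>y\<in>Y. Q a y * c x y) = mat_id a x"
    using span by metis
  define P where "P y x = c x y" for y x
  have QP: "mat_mult Y Q P a x = mat_id a x" if "a \<in> X" "x \<in> X" for a x
    using c that by (simp add: mat_mult_def P_def)
  have PQ: "mat_mult X P Q y z = mat_id y z" if "y \<in> Y" "z \<in> Y" for y z
    using square_right_inverse_is_left_inverse[OF fin card QP that] .
  have "mat_mult X P (A g) y x = mat_mult Y (B g) P y x" if g: "g \<in> G" and y: "y \<in> Y" and x: "x \<in> X" for g y x
  proof -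
    \<comment> \<open>In matrix notation: PA = PAQP = PQBP = BP.\<close>
    have "mat_mult X P (A g) y x = (\<Sum>a\<in>X. P y a * (\<Sum>d\<in>X. A g a d * mat_id d x))"
      using fin x by (simp add: mat_mult_def sum_mat_id)
    also have "\<dots> = (\<Sum>a\<in>X. P y a * (\<Sum>d\<in>X. A g a d * (\<Sum>z\<in>Y. Q d z * P z x)))"
      using QP[OF _ x] by (simp add: mat_mult_def)
    also have "\<dots> = (\<Sum>a\<in>X. P y a * (\<Sum>z\<in>Y. (\<Sum>d\<in>X. A g a d * Q d z) * P z x))"
      by (simp add: sum_mat_assoc)
    also have "\<dots> = (\<Sum>a\<in>X. P y a * (\<Sum>z\<in>Y. (\<Sum>w\<in>Y. Q a w * B g w z) * P z x))"
      using inter[OF g] by simp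
    also have "\<dots> = (\<Sum>a\<in>X. P y a * (\<Sum>w\<in>Y. Q a w * (\<Sum>z\<in>Y. B g w z * P z x)))"
      by (simp add: sum_mat_assoc)
    also have "\<dots> = (\<Sum>w\<in>Y. (\<Sum>a\<in>X. P y a * Q a w) * (\<Sum>z\<in>Y. B g w z * P z x))"
      by (rule sum_mat_assoc)
    also have "\<dots> = (\<Sum>w\<in>Y. mat_id y w * (\<Sum>z\<in>Y. B g w z * P z x))"
      using PQ[OF y] by (simp add: mat_mult_def)
    also have "\<dots> = mat_mult Y (B g) P y x"
      using fin y by (simp add: mat_mult_def sum_mat_id)
    finally show ?thesis .
  qed
  then show ?thesis unfolding rep_iso_def using QP PQ by blast
qed

locale B_tableaux =
  fixes D :: "box set" and n m :: nat
  assumes skew: "skew_shape D" and cardD: "card D = n" and m: "1 \<le> m"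
begin

abbreviation "X \<equiv> Btab D m n"
abbreviation "Z \<equiv> syt D n"
abbreviation "R \<equiv> transversal (Bgroup n) (Sgroup n)"
abbreviation "\<rho> \<equiv> rho_rep D m n"

lemma finite_X: "finite X"
  using skew by (simp add: finite_Btab skew_shape_finite)

lemma Z_subset_X: "Z \<subseteq> X"
  using syt_Btab by blast

lemma finite_Z: "finite Z"
  using Z_subset_X finite_X by (rule finite_subset)

lemma word_mat_well_defined:
  assumes "set us \<subseteq> {..<n}" "set ws \<subseteq> {..<n}" "word_perm us = word_perm ws" "T \<in> X" "U \<in> X"
  shows "word_mat X (rho_gen D m) us T U = word_mat X (rho_gen D m) ws T U"
  using coxeter_congruence.perm_eq_imp_congruent[OF rho_coxeter_congruence[OF skew m] order_refl assms(1-3)]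
    assms(4,5) by (simp add: rho_congruent_def)

lemma rho_word:
  assumes "set ws \<subseteq> {..<n}" "T \<in> X" "U \<in> X"
  shows "\<rho> (word_perm ws) T U = word_mat X (rho_gen D m) ws T U"
proof -
  have "ext_rep X (rho_gen D m) {..<n} (word_perm ws)
      = (\<lambda>a c. if a \<in> X \<and> c \<in> X then word_mat X (rho_gen D m) ws a c else 0)"
    using word_mat_well_defined[OF _ assms(1)] by (intro ext_rep_word[OF assms(1)])
  then show ?thesis using assms(2,3) by (simp add: rho_rep_def)
qed

lemma rho_id: "T \<in> X \<Longrightarrow> U \<in> X \<Longrightarrow> \<rho> id T U = mat_id T U"
  using rho_word[of "[]"] by (simp add: word_mat_Nil)

lemma rho_gen_eq: "i < n \<Longrightarrow> T \<in> X \<Longrightarrow> U \<in> X \<Longrightarrow> \<rho> (gen i) T U = rho_gen D m i T U"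
  using rho_word[of "[i]"] by (simp add: word_mat_Cons word_mat_Nil sum_mat_id finite_X)

lemma rho_comp:
  assumes "g \<in> Bgroup n" "h \<in> Bgroup n" "T \<in> X" "U \<in> X"
  shows "\<rho> (g \<circ> h) T U = (\<Sum>V\<in>X. \<rho> g T V * \<rho> h V U)"
proof -
  obtain us ws where us: "set us \<subseteq> {..<n}" "word_perm us = g" and ws: "set ws \<subseteq> {..<n}" "word_perm ws = h"
    using Bgroup_word assms(1,2) by metis
  have "\<rho> (word_perm (us @ ws)) T U = (\<Sum>V\<in>X. \<rho> (word_perm us) T V * \<rho> (word_perm ws) V U)"
    using us(1) ws(1) assms(3,4) by (simp add: rho_word word_mat_append[OF finite_X] del: word_perm_append)
  then show ?thesis using us ws by simp
qed

lemma rho_Sgroup: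
  assumes h: "h \<in> Sgroup n" and Q: "Q \<in> Z" and T: "T \<in> X"
  shows "\<rho> h T Q = (if T \<in> Z then specht_rep D n h T Q else 0)"
proof -
  obtain ws where ws: "set ws \<subseteq> {1..<n}" "word_perm ws = h" using Sgroup_word[OF h] by blast
  have sub: "set us \<subseteq> {..<n}" if "set us \<subseteq> {1..<n}" for us :: "nat list" using that by auto
  have "word_mat Z (young_gen D) us a c = word_mat Z (young_gen D) ws a c"
    if "set us \<subseteq> {1..<n}" "word_perm us = word_perm ws" "a \<in> Z" "c \<in> Z" for us a c
  proof -
    have "a \<in> X" "c \<in> X" using that Z_subset_X by auto
    then show ?thesis
      using word_mat_syt[OF skew that(4,1) \<open>a \<in> X\<close>] word_mat_syt[OF skew that(4) ws(1) \<open>a \<in> X\<close>]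
        word_mat_well_defined[OF sub[OF that(1)] sub[OF ws(1)] that(2)] that(3) by simp
  qed
  then have "specht_rep D n h T Q = (if T \<in> Z \<and> Q \<in> Z then word_mat Z (young_gen D) ws T Q else 0)"
    unfolding specht_rep_def ws(2)[symmetric] by (subst ext_rep_word[OF ws(1)]) auto
  moreover have "\<rho> h T Q = word_mat X (rho_gen D m) ws T Q"
    using rho_word[OF sub[OF ws(1)] T] Q Z_subset_X ws(2) by auto
  ultimately show ?thesis using word_mat_syt[OF skew Q ws(1) T] Q by simp
qed

text \<open>Writing g = sh with s in the transversal and h in S_n, only the summand r = s survives,
  and it is the product formula for sh. Applied to \<open>g \<circ> r\<close> this is the
  intertwining property; applied to \<open>id\<close> it places positive tableaux in the
  image.\<close>

lemma rho_coset_expansion: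
  assumes g: "g \<in> Bgroup n" and Q: "Q \<in> Z" and T: "T \<in> X"
  shows "\<rho> g T Q = (\<Sum>(r, V)\<in>R \<times> Z. \<rho> r T V *
    (if inv r \<circ> g \<in> Sgroup n then specht_rep D n (inv r \<circ> g) V Q else 0))"
proof -
  obtain s where s: "s \<in> R" "s ` {1..int n} = g ` {1..int n}" using transversal_ex[OF g] .
  have sB: "s \<in> Bgroup n" using transversal_Bgroup[OF s(1)] .
  have QX: "Q \<in> X" using Q Z_subset_X by blast
  define h where "h = inv s \<circ> g"
  have h: "h \<in> Sgroup n" unfolding h_def using inv_comp_Sgroup_iff[OF sB g] s(2) by simp
  have only: "inv r \<circ> g \<in> Sgroup n \<longleftrightarrow> r = s" if r: "r \<in> R" for r
    using inv_comp_Sgroup_iff[OF transversal_Bgroup[OF r] g] transversal_image_eq[OF r s(1)] s(2) by auto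
  have "(\<Sum>(r, V)\<in>R \<times> Z. \<rho> r T V *
      (if inv r \<circ> g \<in> Sgroup n then specht_rep D n (inv r \<circ> g) V Q else 0))
    = (\<Sum>r\<in>R. \<Sum>V\<in>Z. \<rho> r T V * (if inv r \<circ> g \<in> Sgroup n then specht_rep D n (inv r \<circ> g) V Q else 0))"
    by (simp add: sum.cartesian_product)
  also have "\<dots> = (\<Sum>r\<in>R. if r = s then \<Sum>V\<in>Z. \<rho> s T V * specht_rep D n h V Q else 0)"
    by (intro sum.cong) (auto simp: only h_def)
  also have "\<dots> = (\<Sum>V\<in>Z. \<rho> s T V * specht_rep D n h V Q)"
    using s(1) finite_transversal by simp
  \<comment> \<open>The added terms vanish: column \<open>Q\<close> of an element of S_n is
    supported on positive tableaux.\<close>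
  also have "\<dots> = (\<Sum>V\<in>X. \<rho> s T V * \<rho> h V Q)"
    using finite_X Z_subset_X h Q by (intro sum.mono_neutral_cong_left) (auto simp: rho_Sgroup)
  also have "\<dots> = \<rho> (s \<circ> h) T Q" using rho_comp[OF sB Sgroup_Bgroup[OF h] T QX] by simp
  also have "s \<circ> h = g" using Bgroup_bij[OF sB] by (simp add: h_def fun_eq_iff bij_is_surj surj_f_inv_f)
  finally show ?thesis by (rule sym)
qed

section \<open>The image of the intertwiner\<close>

definition in_image :: "(filling \<Rightarrow> real) \<Rightarrow> bool" where
  "in_image v \<longleftrightarrow> (\<exists>c. \<forall>T\<in>X. v T = (\<Sum>(r, Q)\<in>R \<times> Z. \<rho> r T Q * c (r, Q)))"

lemma in_image_cong: "in_image v \<Longrightarrow> (\<And>T. T \<in> X \<Longrightarrow> w T = v T) \<Longrightarrow> in_image w"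
  by (simp add: in_image_def)

lemma in_image_scale: "in_image v \<Longrightarrow> in_image (\<lambda>T. a * v T)"
  unfolding in_image_def
proof (elim exE)
  fix c assume "\<forall>T\<in>X. v T = (\<Sum>(r, Q)\<in>R \<times> Z. \<rho> r T Q * c (r, Q))"
  then show "\<exists>c. \<forall>T\<in>X. a * v T = (\<Sum>(r, Q)\<in>R \<times> Z. \<rho> r T Q * c (r, Q))"
    by (intro exI[of _ "\<lambda>y. a * c y"]) (simp add: sum_distrib_left case_prod_beta mult.left_commute)
qed

lemma in_image_add: "in_image v \<Longrightarrow> in_image w \<Longrightarrow> in_image (\<lambda>T. v T + w T)"
  unfolding in_image_def
proof (elim exE)
  fix c d assume "\<forall>T\<in>X. v T = (\<Sum>(r, Q)\<in>R \<times> Z. \<rho> r T Q * c (r, Q))"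
    "\<forall>T\<in>X. w T = (\<Sum>(r, Q)\<in>R \<times> Z. \<rho> r T Q * d (r, Q))"
  then show "\<exists>c. \<forall>T\<in>X. v T + w T = (\<Sum>(r, Q)\<in>R \<times> Z. \<rho> r T Q * c (r, Q))"
    by (intro exI[of _ "\<lambda>y. c y + d y"]) (simp add: case_prod_beta distrib_left sum.distrib)
qed

lemma rho_intertwines:
  assumes g: "g \<in> Bgroup n" and T: "T \<in> X" and rQ: "r \<in> R" "Q \<in> Z"
  shows "(\<Sum>V\<in>X. \<rho> g T V * \<rho> r V Q)
    = (\<Sum>(s, V)\<in>R \<times> Z. \<rho> s T V * induced_rep (Sgroup n) (specht_rep D n) g (s, V) (r, Q))"
proof -
  have r: "r \<in> Bgroup n" using transversal_Bgroup[OF rQ(1)] .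
  have "(\<Sum>V\<in>X. \<rho> g T V * \<rho> r V Q) = \<rho> (g \<circ> r) T Q"
    using rho_comp[OF g r T] rQ(2) Z_subset_X by auto
  also have "\<dots> = (\<Sum>(s, V)\<in>R \<times> Z. \<rho> s T V * induced_rep (Sgroup n) (specht_rep D n) g (s, V) (r, Q))"
    using rho_coset_expansion[OF Bgroup_comp[OF g r] rQ(2) T] unfolding induced_rep_def comp_assoc by simp
  finally show ?thesis .
qed

lemma in_image_rho:
  assumes g: "g \<in> Bgroup n" and v: "in_image v"
  shows "in_image (\<lambda>T. \<Sum>V\<in>X. \<rho> g T V * v V)"
proof -
  let ?Y = "R \<times> Z" and ?B = "induced_rep (Sgroup n) (specht_rep D n) g"
  let ?q = "\<lambda>T (r, Q). \<rho> r T Q"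
  obtain c where c: "\<And>V. V \<in> X \<Longrightarrow> v V = (\<Sum>y\<in>?Y. ?q V y * c y)"
    using v by (auto simp: in_image_def case_prod_beta)
  have inter: "(\<Sum>V\<in>X. \<rho> g T V * ?q V y) = (\<Sum>z\<in>?Y. ?q T z * ?B z y)" if "T \<in> X" "y \<in> ?Y" for T y
    using rho_intertwines[OF g that(1)] that(2) by (auto simp: case_prod_beta)
  have "(\<Sum>V\<in>X. \<rho> g T V * v V) = (\<Sum>z\<in>?Y. ?q T z * (\<Sum>y\<in>?Y. ?B z y * c y))" if T: "T \<in> X" for T
  proof -
    have "(\<Sum>V\<in>X. \<rho> g T V * v V) = (\<Sum>V\<in>X. \<rho> g T V * (\<Sum>y\<in>?Y. ?q V y * c y))" using c by simp
    also have "\<dots> = (\<Sum>y\<in>?Y. (\<Sum>V\<in>X. \<rho> g T V * ?q V y) * c y)" by (rule sum_mat_assoc)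
    also have "\<dots> = (\<Sum>y\<in>?Y. (\<Sum>z\<in>?Y. ?q T z * ?B z y) * c y)" using inter[OF T] by (intro sum.cong) auto
    also have "\<dots> = (\<Sum>z\<in>?Y. ?q T z * (\<Sum>y\<in>?Y. ?B z y * c y))" by (rule sum_mat_assoc[symmetric])
    finally show ?thesis .
  qed
  then show ?thesis unfolding in_image_def
    by (intro exI[of _ "\<lambda>z. \<Sum>y\<in>?Y. ?B z y * c y"]) (simp add: case_prod_beta)
qed

text \<open>Every standard B-tableau is reached from one with positive entries only by moving the
  negative entry of least absolute value to \<open>-1\<close> and flipping its sign; none of these steps is
  degenerate because \<open>m \<ge> 1\<close> makes their denominators at least \<open>3\<close> in absolute value.\<close>

lemma basis_in_image: "T \<in> X \<Longrightarrow> in_image (\<lambda>V. mat_id V T)"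
proof (induction "\<Sum>b\<in>D. nat (- T b)" arbitrary: T rule: less_induct)
  case less
  have finD: "finite D" using skew by (rule skew_shape_finite)
  have sf: "T \<in> signed_fillings D n" using less.prems by (simp add: Btab_eq)
  show ?case
  proof (cases "\<forall>b\<in>D. 0 < T b")
    case True
    then have Q: "T \<in> Z" using less.prems by (simp add: syt_eq[of D n m])
    \<comment> \<open>The chosen representative of S_n itself may differ from the identity, so even
      a positive tableau is written through the coset expansion.\<close>
    have "mat_id V T = (\<Sum>(r, Q)\<in>R \<times> Z. \<rho> r V Q *
        (if inv r \<circ> id \<in> Sgroup n then specht_rep D n (inv r \<circ> id) Q T else 0))" if "V \<in> X" for V
      using rho_coset_expansion[OF id_Bgroup Q that] rho_id[OF that less.prems] by simp
    then show ?thesis unfolding in_image_def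
      by (intro exI[of _ "\<lambda>(r, Q). if inv r \<circ> id \<in> Sgroup n then specht_rep D n (inv r \<circ> id) Q T else 0"]) auto
  next
    case False
    define K where "K = (\<lambda>b. nat (- T b)) ` {b \<in> D. T b < 0}"
    have "\<exists>b\<in>D. T b < 0"
      using False entry_signed_set[OF sf] by (force simp: signed_set_def)
    then have "K \<noteq> {}" "finite K" using finD by (auto simp: K_def)
    then have "Min K \<in> K" and min: "\<And>k. k \<in> K \<Longrightarrow> Min K \<le> k" by auto
    then obtain b where b: "b \<in> D" "T b < 0" "Min K = nat (- T b)" by (auto simp: K_def)
    \<comment> \<open>With this index the entry of \<open>b\<close> is -(i + 1), and
      \<open>gen i\<close> turns it into -i, or into 1 when i = 0.\<close>
    define i where "i = nat (- T b) - 1"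
    have Tb: "T b = - int i - 1" using b by (simp add: i_def)
    have i: "i < n" using entry_signed_set[OF sf b(1)] Tb by (auto simp: signed_set_def)
    have small: "T x \<ge> 0 \<or> T x \<le> - int i - 1" if "x \<in> D" for x
      using min[of "nat (- T x)"] that Tb b(3) by (cases "T x < 0") (auto simp: K_def)
    let ?T = "act (gen i) T"
    have f3: "1 < \<bar>fvec D m T i\<bar>"
    proof (cases "i = 0")
      case True
      then show ?thesis using abs_bcv_ge[OF finD sf, of 1 m] i m by (simp add: fvec_def signed_set_def)
    next
      case False
      then have "int i \<in> signed_set n" using i by (simp add: signed_set_def)
      with sf obtain x where x: "x \<in> D" "int i = T x"
      proof (rule entry_cases)
        fix x assume "x \<in> D" "int i = - T x"
        then show thesis using small[of x] False by auto
      qed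
      have "bcv D m T (int i) = bcontent D m x" "bcv D m T (int i + 1) = - bcontent D m b"
        using bcv_entry(1)[OF sf x(1)] bcv_entry(2)[OF sf b(1)] x(2) Tb by (simp_all add: add.commute)
      then have "fvec D m T i = - bcontent D m b - bcontent D m x" using False by (simp add: fvec_def)
      then show ?thesis using bcontent_ge[OF finD b(1), of m] bcontent_ge[OF finD x(1), of m] m by simp
    qed
    then have TX: "?T \<in> X" using act_gen_not_standard[OF skew less.prems i] by force
    have f': "fvec D m ?T i = - fvec D m T i" using fvec_act_gen(1)[OF sf i] .
    have "(\<Sum>x\<in>D. nat (- ?T x)) < (\<Sum>x\<in>D. nat (- T x))"
    proof (rule sum_strict_mono_ex1[OF finD])
      show "\<forall>x\<in>D. nat (- ?T x) \<le> nat (- T x)"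
      proof
        fix x assume x: "x \<in> D"
        \<comment> \<open>The measure counts negative entries only; it could grow for
          \<open>i = 0\<close> if a 1 became -1, but -1 is already an entry.\<close>
        have "i = 0 \<Longrightarrow> T x \<noteq> 1" using minus_entry[OF sf b(1)] x Tb by force
        then show "nat (- ?T x) \<le> nat (- T x)"
          using small[OF x] by (cases "i = 0") (auto simp: act_def gen_apply)
      qed
      show "\<exists>x\<in>D. nat (- ?T x) < nat (- T x)"
        using b(1) Tb by (intro bexI[of _ b]) (auto simp: act_def gen_apply)
    qed
    then have IH: "in_image (\<lambda>V. mat_id V ?T)" using less.hyps TX by blast
    define f where "f = fvec D m T i"
    define \<beta> where "\<beta> = sqrt (1 - 1 / f\<^sup>2)"
    have "1 < f\<^sup>2" using f3 unfolding f_def by (metis abs_1 abs_le_square_iff linorder_not_less one_power2)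
    then have \<beta>: "\<beta> \<noteq> 0" by (auto simp: \<beta>_def)
    have neq: "?T \<noteq> T"
    proof
      assume "?T = T"
      then have "gen i (T b) = T b" by (metis act_def)
      then show False using Tb by (auto simp: gen_apply split: if_splits)
    qed
    \<comment> \<open>The generator sends \<open>?T\<close> to -1/f times \<open>?T\<close> plus
      \<beta> times \<open>T\<close>, and this is solved for \<open>T\<close>.\<close>
    have "mat_id V T = 1 / \<beta> * ((\<Sum>W\<in>X. \<rho> (gen i) V W * mat_id W ?T) + 1 / f * mat_id V ?T)" if V: "V \<in> X" for V
    proof -
      have "(\<Sum>W\<in>X. \<rho> (gen i) V W * mat_id W ?T) = rho_gen D m i V ?T"
        using sum_mat_id(2)[OF finite_X TX] rho_gen_eq[OF i V TX] by simp
      also have "\<dots> = (if V = ?T then - (1 / f) else 0) + (if V = T then \<beta> else 0)"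
        by (simp add: rho_gen_def Let_def f' \<beta>_def f_def)
      finally show ?thesis using \<beta> neq by (auto simp: mat_id_def)
    qed
    moreover have "in_image (\<lambda>V. 1 / \<beta> * ((\<Sum>W\<in>X. \<rho> (gen i) V W * mat_id W ?T) + 1 / f * mat_id V ?T))"
      by (rule in_image_scale[OF in_image_add[OF in_image_rho[OF gen_Bgroup[OF i] IH] in_image_scale[OF IH]]])
    ultimately show ?thesis by (rule in_image_cong[rotated])
  qed
qed

lemma rep_iso_rho:
  "rep_iso X (induced_basis (Bgroup n) (Sgroup n) Z) (Bgroup n) \<rho> (induced_rep (Sgroup n) (specht_rep D n))"
proof (rule rep_isoI[where Q = "\<lambda>T (r, Q). \<rho> r T Q"])
  let ?Y = "induced_basis (Bgroup n) (Sgroup n) Z"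
  show "finite X" by (rule finite_X)
  show "finite ?Y" using finite_transversal finite_Z by (simp add: induced_basis_def)
  show "card X = card ?Y" using card_induced_basis[OF skew cardD] by simp
  fix T assume T: "T \<in> X"
  show "\<exists>c. \<forall>a\<in>X. (\<Sum>y\<in>?Y. (case y of (r, Q) \<Rightarrow> \<rho> r a Q) * c y) = mat_id a T"
    using basis_in_image[OF T] unfolding in_image_def induced_basis_def
    by (auto simp: case_prod_beta intro: sym)
  fix g y assume "g \<in> Bgroup n" "y \<in> ?Y"
  then show "(\<Sum>z\<in>X. \<rho> g T z * (case y of (r, Q) \<Rightarrow> \<rho> r z Q))
      = (\<Sum>z\<in>?Y. (case z of (r, Q) \<Rightarrow> \<rho> r T Q) * induced_rep (Sgroup n) (specht_rep D n) g z y)"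
    using rho_intertwines[of g T] T by (auto simp: induced_basis_def case_prod_beta)
qed

end

theorem theorem6p10:
  fixes D :: "box set" and n m :: nat
  assumes "skew_shape D" and "card D = n" and "1 \<le> m"
  shows "rep_iso (Btab D m n) (induced_basis (Bgroup n) (Sgroup n) (syt D n)) (Bgroup n)
           (rho_rep D m n) (induced_rep (Sgroup n) (specht_rep D n))"
proof -
  interpret B_tableaux D n m using assms by unfold_locales
  show ?thesis by (rule rep_iso_rho)
qed

end
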